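(* Fix a prime power $q$. For an integer $n\ge 1$, let $\mathcal{N}_q(n)$ denote the number of $q$-matroids on $\mathbb{F}_q^n$ and $\mathcal{R}_q(n)$ the number of representable $q$-matroids on $\mathbb{F}_q^n$. Then \[ \lim_{n\to\infty}\frac{\mathcal{R}_q(n)}{\mathcal{N}_q(n)}=0. \]
   Context: A $q$-matroid on $E=\mathbb{F}_q^n$ is a function $\rho$ from the set $\mathcal{L}(E)$ of all $\mathbb{F}_q$-subspaces of $E$ to $\mathbb{Z}_{\ge0}$ such that for all subspaces $X,Y$: $0\le\rho(X)\le\dim X$; $X\le Y$ implies $\rho(X)\le\rho(Y)$; and $\rho(X\cap Y)+\rho(X+Y)\le\rho(X)+\rho(Y)$. Distinct $q$-matroids on $E$ are distinct such functions. Its rank is $\rho(E)$. A $q$-matroid of rank $k$ on $\mathbb{F}_q^n$ is representable if there exist $m\ge1$ and a matrix $G\in\mathbb{F}_{q^m}^{k\times n}$ of rank $k$ (equivalently, an $\mathbb{F}_{q^m}$-linear code $\mathcal{C}\le\mathbb{F}_{q^m}^n$ with generator matrix $G$) such that for every subspace $V\le\mathbb{F}_q^n$, $\rho(V)=\mathrm{rk}_{\mathbb{F}_{q^m}}(GY^T)$, where $Y$ is any matrix over $\mathbb{F}_q$ whose row space is $V$; the rank-$0$ $q$-matroid ($\rho\equiv0$, arising from the zero code) is also representable. *)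

theory Defs
  imports "HOL-Algebra.Algebraic_Closure_Type" "HOL-Algebra.Subrings"
    "Jordan_Normal_Form.DL_Rank" "HOL-Library.FuncSet" "HOL-Library.Cardinality"
begin

section \<open>\<open>q\<close>-matroids\<close>

text \<open>
  The field with \<open>q\<close> elements is a type \<open>'a :: {finite, field}\<close> with \<open>q = CARD('a)\<close>; its
  \<open>n\<close>-dimensional coordinate space is \<open>carrier_vec n\<close>.
\<close>

context vec_space
begin

definition subspaces :: "'a vec set set" where
  "subspaces = {W. VectorSpace.subspace class_ring W V}"

definition subspace_dim :: "'a vec set \<Rightarrow> nat" where
  "subspace_dim W = vectorspace.dim class_ring (vs W)"

definition q_matroid :: "('a vec set \<Rightarrow> nat) \<Rightarrow> bool" where
  "q_matroid \<rho> \<longleftrightarrow>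
     (\<forall>A\<in>subspaces. \<rho> A \<le> subspace_dim A) \<and>
     (\<forall>A\<in>subspaces. \<forall>B\<in>subspaces. A \<subseteq> B \<longrightarrow> \<rho> A \<le> \<rho> B) \<and>
     (\<forall>A\<in>subspaces. \<forall>B\<in>subspaces. \<rho> (A \<inter> B) + \<rho> (subspace_sum A B) \<le> \<rho> A + \<rho> B)"

text \<open>
  A function with domain \<open>subspaces\<close> is represented by an extensional one, so that distinct
  members of the following set differ on some subspace.
\<close>

definition q_matroids :: "('a vec set \<Rightarrow> nat) set" where
  "q_matroids = {\<rho> \<in> extensional subspaces. q_matroid \<rho>}"

end


section \<open>Matrix rank over a subfield\<close>

text \<open>
  For a subfield \<open>K\<close> of a type \<open>'b\<close>, these are \<open>K\<close> as a ring, \<open>K\<^sup>n\<close> as a \<open>K\<close>-space, and the rank over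
  \<open>K\<close> of a matrix with entries in \<open>K\<close>. The last repeats \<^const>\<open>vec_space.rank\<close> with scalars
  restricted to \<open>K\<close>.
\<close>

definition subfield_ring :: "'b::field set \<Rightarrow> 'b ring" where
  "subfield_ring K = class_ring\<lparr>carrier := K\<rparr>"

definition subfield_vec :: "'b::field set \<Rightarrow> nat \<Rightarrow> ('b, 'b vec) module" where
  "subfield_vec K n = (module_vec TYPE('b) n)\<lparr>carrier := {v \<in> carrier_vec n. \<forall>i<n. vec_index v i \<in> K}\<rparr>"

definition rank_over :: "'b::field set \<Rightarrow> 'b mat \<Rightarrow> nat" where
  "rank_over K A =
     (let F = subfield_ring K; U = subfield_vec K (dim_row A)
      in vectorspace.dim F (U\<lparr>carrier := LinearCombinations.module.span F U (set (cols A))\<rparr>))"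

lemma field_subfield_ring:
  assumes "subfield K (class_ring :: 'b::field ring)" shows "field (subfield_ring K)"
  using ring.subfield_iff(2)[OF _ assms] class_ring.ring_axioms unfolding subfield_ring_def by blast

lemma vectorspace_subfield_vec:
  assumes K: "subfield K (class_ring :: 'b::field ring)"
  shows "vectorspace (subfield_ring K) (subfield_vec K n)"
proof -
  interpret F: field "subfield_ring K" by (rule field_subfield_ring[OF K])
  have cl: "0 \<in> K" "1 \<in> K" "a + b \<in> K" "a * b \<in> K" if "a \<in> K" "b \<in> K" for a b
    using F.zero_closed F.one_closed F.a_closed[of a b] F.m_closed[of a b] that
    by (auto simp: subfield_ring_def)
  have z: "0 \<in> K" using F.zero_closed by (simp add: subfield_ring_def)
  have neg: "- a \<in> K" if a: "a \<in> K" for a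
  proof -
    obtain b where "b \<in> K" "b + a = 0"
      using F.l_neg[of a] F.a_inv_closed[of a] a by (auto simp: subfield_ring_def)
    then show ?thesis by (metis minus_unique add.commute)
  qed
  show ?thesis
  proof (rule vectorspace.intro[OF _ F.field_axioms], rule moduleI[OF F.cring_axioms])
    show "abelian_group (subfield_vec K n)"
    proof (rule abelian_groupI)
      fix x assume "x \<in> carrier (subfield_vec K n)"
      then show "\<exists>y\<in>carrier (subfield_vec K n). y \<oplus>\<^bsub>subfield_vec K n\<^esub> x = \<zero>\<^bsub>subfield_vec K n\<^esub>"
        by (intro bexI[of _ "- x"]) (auto simp: subfield_vec_def module_vec_simps neg)
    qed (auto simp: subfield_vec_def module_vec_simps cl z)
  qed (auto simp: subfield_vec_def subfield_ring_def module_vec_simps cl z add_smult_distrib_vec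
      smult_add_distrib_vec smult_smult_assoc)
qed

lemma rank_over_UNIV: "rank_over UNIV A = vec_space.rank (dim_row A) A"
  by (simp add: rank_over_def vec_space.rank_def subfield_ring_def subfield_vec_def module_vec_def Let_def)


section \<open>Representability\<close>

text \<open>
  Finite extensions of the base field are taken inside a fixed algebraic closure: the extension of
  degree \<open>m\<close> is the subfield \<open>K\<close> with \<open>CARD('a) ^ m\<close> elements. For \<open>k = 0\<close> the matrix \<open>G\<close> has no
  rows, which gives the \<open>q\<close>-matroid of rank \<open>0\<close>.
\<close>

definition representable :: "nat \<Rightarrow> ('a::{finite,field} vec set \<Rightarrow> nat) \<Rightarrow> bool" where
  "representable n \<rho> \<longleftrightarrow>
     (\<exists>m\<ge>1. \<exists>K :: 'a alg_closure set.
        subfield K class_ring \<and> range to_ac \<subseteq> K \<and> card K = CARD('a) ^ m \<and>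
        (\<exists>k G. k = \<rho> (carrier_vec n) \<and> G \<in> carrier_mat k n \<and> elements_mat G \<subseteq> K \<and>
           rank_over K G = k \<and>
           (\<forall>W\<in>vec_space.subspaces n. \<forall>l. \<forall>Y\<in>carrier_mat l n.
              vec_space.row_space n Y = W \<longrightarrow>
              \<rho> W = rank_over K (G * (map_mat to_ac Y)\<^sup>T))))"

text \<open>Finiteness makes \<^const>\<open>card\<close> a genuine count.\<close>

lemma finite_q_matroids: "finite (vec_space.q_matroids n :: ('a::{finite,field} vec set \<Rightarrow> nat) set)"
proof -
  let ?S = "vec_space.subspaces n :: 'a vec set set"
  have "finite (carrier_vec n :: 'a vec set)"
  proof -
    have "carrier_vec n \<subseteq> vec_of_list ` {xs :: 'a list. set xs \<subseteq> UNIV \<and> length xs = n}"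
    proof
      fix v :: "'a vec" assume "v \<in> carrier_vec n"
      then show "v \<in> vec_of_list ` {xs :: 'a list. set xs \<subseteq> UNIV \<and> length xs = n}"
        by (intro image_eqI[of _ _ "list_of_vec v"]) (auto simp: vec_list)
    qed
    then show ?thesis by (rule finite_subset) (intro finite_imageI finite_lists_length_eq finite)
  qed
  moreover have "?S \<subseteq> Pow (carrier_vec n)"
    by (auto simp: vec_space.subspaces_def VectorSpace.subspace_def submodule_def module_vec_simps)
  ultimately have S: "finite ?S" by (meson finite_Pow_iff finite_subset)
  have "vec_space.q_matroids n \<subseteq> (\<Pi>\<^sub>E W\<in>?S. {..vec_space.subspace_dim n W})"
    by (auto simp: vec_space.q_matroids_def vec_space.q_matroid_def PiE_def extensional_def Pi_def)
  then show ?thesis by (rule finite_subset) (intro finite_PiE S, simp)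
qed

definition num_q_matroids :: "'a::{finite,field} itself \<Rightarrow> nat \<Rightarrow> nat" where
  "num_q_matroids _ n = card (vec_space.q_matroids n :: ('a vec set \<Rightarrow> nat) set)"

definition num_representable :: "'a::{finite,field} itself \<Rightarrow> nat \<Rightarrow> nat" where
  "num_representable _ n =
     card {\<rho> \<in> vec_space.q_matroids n :: ('a vec set \<Rightarrow> nat) set. representable n \<rho>}"

end

theory Submission
  imports Defs "HOL-Library.Function_Algebras" "HOL-Real_Asymp.Real_Asymp"
begin

text \<open>
  Let \<open>G\<close> be a \<open>k \<times> n\<close> matrix over the algebraic closure that represents \<open>\<rho>\<close>. Extending bases
  shows that \<open>\<rho> W\<close> is the largest number of rows in \<open>W\<close> of a \<open>k \<times> n\<close> matrix \<open>Y\<close> over the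
  field with \<open>q\<close> elements with \<open>det (G Y\<^sup>T) \<noteq> 0\<close>. So \<open>\<rho>\<close> is determined by the zero pattern, at the
  point \<open>G\<close>, of at most \<open>q\<^sup>k\<^sup>n\<close> polynomials of degree \<open>k\<close> in \<open>k n\<close> variables, whatever the degree
  of the extension. By the argument of Ronyai, Babai and Ganapathy there are at most
  \<open>(k q\<^sup>k\<^sup>n + 1)\<^sup>k\<^sup>n\<close> such patterns, so the number of representable \<open>q\<close>-matroids is at most \<open>2\<close> to
  the power of a polynomial in \<open>n\<close>.

  On the other hand there are \<open>q\<^sup>n\<^sup>-\<^sup>3\<close> planes which pairwise intersect trivially. Lowering the rank of
  the members of any subset of them from two to one in the uniform \<open>q\<close>-matroid of rank two gives
  another \<open>q\<close>-matroid, so the number of all \<open>q\<close>-matroids is at least \<open>2\<close> to the power \<open>q\<^sup>n\<^sup>-\<^sup>3\<close>.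
\<close>

section \<open>Zero patterns of polynomial functions\<close>

interpretation fun_space: vector_space "\<lambda>(c :: 'b :: field) f (x :: 'c). c * f x"
  by unfold_locales (auto simp: fun_eq_iff algebra_simps)

definition monomial_fun :: "'v set \<Rightarrow> ('v \<Rightarrow> nat) \<Rightarrow> ('v \<Rightarrow> 'b::comm_monoid_mult) \<Rightarrow> 'b" where
  "monomial_fun V e x = (\<Prod>v\<in>V. x v ^ e v)"

text \<open>Exponents are bounded in each variable separately, so that the spanning set is indexed
  by a box with \<open>(d + 1) ^ card V\<close> points. Functions take the place of formal
  polynomials because only values at points matter.\<close>

definition poly_funs :: "'v set \<Rightarrow> nat \<Rightarrow> (('v \<Rightarrow> 'b::field) \<Rightarrow> 'b) set" where
  "poly_funs V d = fun_space.span (monomial_fun V ` (V \<rightarrow>\<^sub>E {..d}))"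

lemma monomial_fun_in_poly_funs:
  fixes V :: "'v set"
  assumes "\<And>v. v \<in> V \<Longrightarrow> e v \<le> d"
  shows "(monomial_fun V e :: ('v \<Rightarrow> 'b::field) \<Rightarrow> 'b) \<in> poly_funs V d"
proof -
  have "(monomial_fun V (restrict e V) :: ('v \<Rightarrow> 'b) \<Rightarrow> 'b) \<in> poly_funs V d"
    unfolding poly_funs_def using assms by (intro fun_space.span_base imageI) auto
  moreover have "monomial_fun V (restrict e V) = (monomial_fun V e :: ('v \<Rightarrow> 'b) \<Rightarrow> 'b)"
    by (auto simp: monomial_fun_def fun_eq_iff intro!: prod.cong)
  ultimately show ?thesis by simp
qed

lemma poly_funs_mono: "d \<le> d' \<Longrightarrow> poly_funs V d \<subseteq> poly_funs V d'"
  unfolding poly_funs_def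
  by (intro fun_space.span_mono image_mono PiE_mono) auto

lemma poly_funs_const: "(\<lambda>_. c) \<in> poly_funs V d"
proof -
  have "(\<lambda>x. c * monomial_fun V (\<lambda>_. 0) x) \<in> poly_funs V d"
    unfolding poly_funs_def
    by (intro fun_space.span_scale monomial_fun_in_poly_funs[unfolded poly_funs_def]) auto
  then show ?thesis by (simp add: monomial_fun_def)
qed

lemma poly_funs_var:
  fixes V :: "'v set"
  assumes "finite V" "v \<in> V" "1 \<le> d"
  shows "(\<lambda>x :: 'v \<Rightarrow> 'b::field. x v) \<in> poly_funs V d"
proof -
  have "(\<Prod>w\<in>V. x w ^ (if w = v then 1 else 0)) = x v" for x :: "'v \<Rightarrow> 'b"
    using assms by (subst prod.mono_neutral_right[of V "{v}"]) auto
  then have "monomial_fun V (\<lambda>w. if w = v then 1 else 0) = (\<lambda>x :: 'v \<Rightarrow> 'b. x v)"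
    by (simp add: monomial_fun_def fun_eq_iff)
  then show ?thesis using monomial_fun_in_poly_funs[of V "\<lambda>w. if w = v then 1 else 0" d, where ?'b = 'b] assms
    by simp
qed

lemma poly_funs_cmult: "f \<in> poly_funs V d \<Longrightarrow> (\<lambda>x. c * f x) \<in> poly_funs V d"
  unfolding poly_funs_def by (rule fun_space.span_scale)

lemma poly_funs_add:
  assumes "f \<in> poly_funs V d" "g \<in> poly_funs V d"
  shows "(\<lambda>x. f x + g x) \<in> poly_funs V d"
  using fun_space.span_add[OF assms[unfolded poly_funs_def]] by (simp add: poly_funs_def plus_fun_def)

lemma poly_funs_sum:
  assumes "\<And>i. i \<in> I \<Longrightarrow> f i \<in> poly_funs V d"
  shows "(\<lambda>x. \<Sum>i\<in>I. f i x) \<in> poly_funs V d"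
proof -
  have "(\<Sum>i\<in>I. f i) \<in> poly_funs V d"
    using assms unfolding poly_funs_def by (rule fun_space.span_sum)
  moreover have "(\<Sum>i\<in>I. f i) = (\<lambda>x. \<Sum>i\<in>I. f i x)"
    by (induction I rule: infinite_finite_induct) (auto simp: fun_eq_iff)
  ultimately show ?thesis by simp
qed

text \<open>By bilinearity it suffices to multiply monomials, where exponents add: one span
  induction on \<open>g\<close> against a fixed monomial, then one on \<open>f\<close>.\<close>

lemma poly_funs_mult:
  fixes V :: "'v set" and f g :: "('v \<Rightarrow> 'b::field) \<Rightarrow> 'b"
  assumes "f \<in> poly_funs V a" "g \<in> poly_funs V b"
  shows "(\<lambda>x. f x * g x) \<in> poly_funs V (a + b)"
proof -
  have 1: "(\<lambda>x. monomial_fun V e x * g x) \<in> poly_funs V (a + b)" if e: "e \<in> V \<rightarrow>\<^sub>E {..a}" for e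
    using assms(2) unfolding poly_funs_def[of V b]
  proof (induction g rule: fun_space.span_induct_alt)
    case base
    show ?case using poly_funs_const[of 0] by (simp add: zero_fun_def)
  next
    case (step c m h)
    then obtain e' where e': "e' \<in> V \<rightarrow>\<^sub>E {..b}" "m = monomial_fun V e'" by auto
    have "monomial_fun V (\<lambda>v. e v + e' v) \<in> (poly_funs V (a + b) :: (('v \<Rightarrow> 'b) \<Rightarrow> 'b) set)"
      using e e' by (intro monomial_fun_in_poly_funs) (auto intro!: add_mono simp: PiE_iff)
    moreover have "monomial_fun V (\<lambda>v. e v + e' v) = (\<lambda>x. monomial_fun V e x * m x)"
      by (simp add: e' monomial_fun_def fun_eq_iff power_add prod.distrib)
    ultimately have "(\<lambda>x. monomial_fun V e x * m x) \<in> poly_funs V (a + b)" by simp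
    from poly_funs_add[OF poly_funs_cmult[OF this] step.IH]
    show ?case by (simp add: plus_fun_def algebra_simps)
  qed
  show ?thesis using assms(1) unfolding poly_funs_def[of V a]
  proof (induction f rule: fun_space.span_induct_alt)
    case base
    show ?case using poly_funs_const[of 0] by (simp add: zero_fun_def)
  next
    case (step c m h)
    then have "(\<lambda>x. m x * g x) \<in> poly_funs V (a + b)" using 1 by auto
    from poly_funs_add[OF poly_funs_cmult[OF this] step.IH]
    show ?case by (simp add: plus_fun_def algebra_simps)
  qed
qed

lemma poly_funs_prod:
  assumes "finite I" "\<And>i. i \<in> I \<Longrightarrow> f i \<in> poly_funs V d"
  shows "(\<lambda>x. \<Prod>i\<in>I. f i x) \<in> poly_funs V (d * card I)"
  using assms
proof (induction I rule: finite_induct)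
  case empty
  then show ?case using poly_funs_const[of 1] by simp
next
  case (insert i I)
  then show ?case using poly_funs_mult[of "f i" V d "\<lambda>x. \<Prod>i\<in>I. f i x" "d * card I"] by simp
qed

section \<open>Counting zero patterns by linear independence\<close>

lemma sum_fun_apply: "(\<Sum>i\<in>I. f i) x = (\<Sum>i\<in>I. f i x)"
  by (induction I rule: infinite_finite_induct) auto

text \<open>Only an upper bound, because over a finite field different exponents can give the same
  function.\<close>

lemma card_monomial_funs_le:
  assumes "finite V"
  shows "finite (monomial_fun V ` (V \<rightarrow>\<^sub>E {..d}))"
    and "card (monomial_fun V ` (V \<rightarrow>\<^sub>E {..d})) \<le> (d + 1) ^ card V"
proof -
  have fin: "finite (V \<rightarrow>\<^sub>E {..d})" using assms by (intro finite_PiE) auto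
  then show "finite (monomial_fun V ` (V \<rightarrow>\<^sub>E {..d}))" by simp
  have "card (V \<rightarrow>\<^sub>E {..d}) = (d + 1) ^ card V" using assms by (simp add: card_PiE)
  then show "card (monomial_fun V ` (V \<rightarrow>\<^sub>E {..d})) \<le> (d + 1) ^ card V"
    using card_image_le[OF fin] by metis
qed

text \<open>The values \<open>g S (u T)\<close> are triangular with respect to inclusion, with
  nonzero diagonal. Evaluating a vanishing combination at \<open>u T\<close>, for an
  inclusion-minimal \<open>T\<close> with nonzero coefficient, leaves only the term of
  \<open>T\<close>.\<close>

lemma independent_triangular_funs:
  fixes g :: "'s set \<Rightarrow> 'c \<Rightarrow> 'b::field"
  assumes P: "finite P" and g: "\<And>S T. S \<in> P \<Longrightarrow> T \<in> P \<Longrightarrow> g S (u T) \<noteq> 0 \<longleftrightarrow> S \<subseteq> T"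
  shows "inj_on g P" and "fun_space.independent (g ` P)"
proof -
  show inj: "inj_on g P"
  proof (rule inj_onI)
    fix S T assume "S \<in> P" "T \<in> P" "g S = g T"
    then have "S \<subseteq> T" "T \<subseteq> S" using g[of S T] g[of T T] g[of T S] g[of S S] by simp_all
    then show "S = T" by (rule equalityI)
  qed
  have "c F = 0"
    if sum0: "(\<Sum>F\<in>g ` P. (\<lambda>x. c F * F x)) = 0" and F: "F \<in> g ` P" for c F
  proof (rule ccontr)
    assume nz: "c F \<noteq> 0"
    define Q where "Q = {S \<in> P. c (g S) \<noteq> 0}"
    have "finite Q" unfolding Q_def using P by simp
    moreover have "Q \<noteq> {}" using F nz unfolding Q_def by blast
    ultimately obtain T where TQ: "T \<in> Q" and min: "\<forall>S\<in>Q. S \<subseteq> T \<longrightarrow> T = S"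
      using finite_has_minimal[of Q] by blast
    have T: "T \<in> P" "c (g T) \<noteq> 0" using TQ unfolding Q_def by blast+
    have zero: "c (g S) * g S (u T) = 0" if "S \<in> P - {T}" for S
    proof (cases "S \<in> Q")
      case True
      then have "\<not> S \<subseteq> T" using min that by blast
      then show ?thesis using g[of S T] T that by simp
    next
      case False
      then show ?thesis using that by (simp add: Q_def)
    qed
    have "(\<Sum>S\<in>P. c (g S) * g S (u T)) = (\<Sum>F\<in>g ` P. c F * F (u T))"
      using inj by (simp add: sum.reindex)
    moreover have "(\<Sum>F\<in>g ` P. c F * F (u T)) = (\<Sum>F\<in>g ` P. (\<lambda>x. c F * F x)) (u T)"
      by (rule sum_fun_apply[symmetric])
    moreover have "(\<Sum>S\<in>P. c (g S) * g S (u T)) = (\<Sum>S\<in>{T}. c (g S) * g S (u T))"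
      using P T zero by (intro sum.mono_neutral_right) simp_all
    ultimately show False using T g[of T T] sum0 by (simp add: zero_fun_def)
  qed
  then show "fun_space.independent (g ` P)"
    using fun_space.independent_if_scalars_zero[OF finite_imageI[OF P]] by blast
qed

text \<open>
  Choosing a point \<open>u S\<close> with pattern \<open>S\<close>, the product of the \<open>f i\<close> over \<open>i \<in> S\<close> does not
  vanish at \<open>u T\<close> iff \<open>S \<subseteq> T\<close>. So these products are linearly independent.
\<close>

lemma card_zero_patterns_le:
  fixes f :: "'i \<Rightarrow> ('v \<Rightarrow> 'b::field) \<Rightarrow> 'b"
  assumes V: "finite V" and I: "finite I" and f: "\<And>i. i \<in> I \<Longrightarrow> f i \<in> poly_funs V d"
  shows "card (range (\<lambda>x. {i \<in> I. f i x \<noteq> 0})) \<le> (d * card I + 1) ^ card V"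
proof -
  define P where "P = range (\<lambda>x. {i \<in> I. f i x \<noteq> 0})"
  have P_sub: "P \<subseteq> Pow I" by (auto simp: P_def)
  then have P_fin: "finite P" using I by (meson finite_Pow_iff finite_subset)
  define u where "u S = (SOME x. {i \<in> I. f i x \<noteq> 0} = S)" for S
  have u: "{i \<in> I. f i (u S) \<noteq> 0} = S" if "S \<in> P" for S
  proof -
    have "\<exists>x. {i \<in> I. f i x \<noteq> 0} = S" using that by (auto simp: P_def)
    then show ?thesis unfolding u_def by (rule someI_ex)
  qed
  define g where "g S x = (\<Prod>i\<in>S. f i x)" for S x
  have g: "g S (u T) \<noteq> 0 \<longleftrightarrow> S \<subseteq> T" if "S \<in> P" "T \<in> P" for S T
  proof -
    have S: "finite S" "S \<subseteq> I" using P_sub that finite_subset[OF _ I, of S] by auto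
    have "g S (u T) \<noteq> 0 \<longleftrightarrow> (\<forall>i\<in>S. f i (u T) \<noteq> 0)" using S by (simp add: g_def)
    also have "\<dots> \<longleftrightarrow> S \<subseteq> {i \<in> I. f i (u T) \<noteq> 0}" using S by auto
    finally show ?thesis unfolding u[OF that(2)] .
  qed
  note indep = independent_triangular_funs[of P g u, OF P_fin g]
  \<comment> \<open>Patterns of different sizes give products of different degrees; the common bound
    \<open>d * card I\<close> puts them all into one space.\<close>
  have "g ` P \<subseteq> poly_funs V (d * card I)"
  proof
    fix F assume "F \<in> g ` P"
    then obtain S where S: "S \<in> P" "F = g S" by (rule imageE)
    have "S \<subseteq> I" using S(1) P_sub by blast
    have "(\<lambda>x. \<Prod>i\<in>S. f i x) \<in> poly_funs V (d * card S)"
      using finite_subset[OF \<open>S \<subseteq> I\<close> I] f \<open>S \<subseteq> I\<close> by (intro poly_funs_prod) auto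
    moreover have "F = (\<lambda>x. \<Prod>i\<in>S. f i x)" by (simp add: S(2) g_def fun_eq_iff)
    moreover have "d * card S \<le> d * card I" 
      using card_mono[OF I \<open>S \<subseteq> I\<close>] by simp
    ultimately show "F \<in> poly_funs V (d * card I)"
      using poly_funs_mono[of "d * card S" "d * card I" V] by blast
  qed
  then have "card (g ` P) \<le> card (monomial_fun V ` (V \<rightarrow>\<^sub>E {..d * card I}) :: (('v \<Rightarrow> 'b) \<Rightarrow> 'b) set)"
    unfolding poly_funs_def
    using fun_space.independent_span_bound[OF card_monomial_funs_le(1)[OF V] indep(2)] by simp
  also have "\<dots> \<le> (d * card I + 1) ^ card V" by (rule card_monomial_funs_le(2)[OF V])
  finally show ?thesis using card_image[OF indep(1)] by (simp add: P_def)
qed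

text \<open>The Leibniz formula is a signed sum of products of \<open>k\<close> entries, and each
  entry is a linear form in the variables \<open>x (i, l)\<close> with coefficients from a column of
  \<open>B\<close>.\<close>

lemma det_mat_mult_in_poly_funs:
  fixes B :: "'b::field mat"
  assumes B: "B \<in> carrier_mat n k"
  shows "(\<lambda>x. det (mat k n x * B)) \<in> poly_funs ({..<k} \<times> {..<n}) k"
proof -
  let ?V = "{..<k} \<times> {..<n} :: (nat \<times> nat) set"
  have entry: "(\<lambda>x. \<Sum>l<n. B $$ (l, j) * x (i, l)) \<in> poly_funs ?V 1" if "i < k" for i j
    using that by (intro poly_funs_sum poly_funs_cmult poly_funs_var) auto
  have "(\<lambda>x. \<Prod>i=0..<k. \<Sum>l<n. B $$ (l, p i) * x (i, l)) \<in> poly_funs ?V (1 * card {0..<k})" for p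
    using entry by (intro poly_funs_prod) auto
  then have "(\<lambda>x. \<Sum>p\<in>{p. p permutes {0..<k}}. signof p * (\<Prod>i=0..<k. \<Sum>l<n. B $$ (l, p i) * x (i, l)))
      \<in> poly_funs ?V k"
    by (intro poly_funs_sum poly_funs_cmult) simp
  moreover have "det (mat k n x * B) =
      (\<Sum>p\<in>{p. p permutes {0..<k}}. signof p * (\<Prod>i=0..<k. \<Sum>l<n. B $$ (l, p i) * x (i, l)))" for x
  proof -
    have "(mat k n x * B) $$ (i, p i) = (\<Sum>l<n. B $$ (l, p i) * x (i, l))"
      if "p permutes {0..<k}" "i \<in> {0..<k}" for p i
    proof -
      have "p i < k" using permutes_in_image[OF that(1), of i] that(2) by simp
      then show ?thesis using that(2) B
        by (auto simp: scalar_prod_def lessThan_atLeast0 mult.commute intro!: sum.cong)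
    qed
    then show ?thesis using B by (auto simp: det_def intro!: sum.cong prod.cong)
  qed
  ultimately show ?thesis by simp
qed


section \<open>Bases over a finite subfield\<close>

lemma (in vectorspace) span_maximal_lin_indpt:
  assumes S: "S \<subseteq> carrier V" and U: "maximal U (\<lambda>T. T \<subseteq> S \<and> lin_indpt T)"
  shows "span U = span S"
proof
  have "U \<subseteq> S" and li: "lin_indpt U" using U by (auto simp: maximal_def)
  then have UV: "U \<subseteq> carrier V" using S by blast
  show "span U \<subseteq> span S" using \<open>U \<subseteq> S\<close> by (rule span_is_monotone)
  have "S \<subseteq> span U"
  proof
    fix s assume s: "s \<in> S"
    show "s \<in> span U"
    proof (rule ccontr)
      assume notin: "s \<notin> span U"
      then have "s \<notin> U" using in_own_span[OF UV] by blast
      moreover have "lin_indpt (U \<union> {s})"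
        using lin_dep_iff_in_span[OF UV li _ \<open>s \<notin> U\<close>] notin s S by blast
      ultimately show False using U s \<open>U \<subseteq> S\<close> unfolding maximal_def by blast
    qed
  qed
  then show "span S \<subseteq> span U" by (rule span_is_subset[OF _ span_is_submodule[OF UV]])
qed

text \<open>A maximal independent subset of \<open>S\<close> is extended to a maximal one of
  \<open>T\<close>. In the main application \<open>S\<close> and \<open>T\<close> are the images of
  a subspace and of the whole space; with \<open>S = T\<close> the lemma extracts a basis from a
  spanning set.\<close>

lemma (in vectorspace) nested_bases:
  assumes T: "finite T" "T \<subseteq> carrier V" and S: "S \<subseteq> T"
  obtains A B where "A \<subseteq> B" "A \<subseteq> S" "B \<subseteq> T" "lin_indpt B"
    "span A = span S" "span B = span T"
    "card A = vectorspace.dim K (span_vs S)" "card B = vectorspace.dim K (span_vs T)"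
proof -
  have finS: "finite S" and SV: "S \<subseteq> carrier V" using T S finite_subset by auto
  obtain A where A: "maximal A (\<lambda>U. U \<subseteq> S \<and> lin_indpt U)"
    using maximal_exists_superset[OF finS, of "\<lambda>U. U \<subseteq> S \<and> lin_indpt U" "{}"]
      finite_lin_indpt2[of "{}"] by auto
  then have "A \<subseteq> T \<and> lin_indpt A" using S by (auto simp: maximal_def)
  then obtain B where B: "maximal B (\<lambda>U. U \<subseteq> T \<and> lin_indpt U)" "A \<subseteq> B"
    using maximal_exists_superset[OF T(1), of "\<lambda>U. U \<subseteq> T \<and> lin_indpt U" A] by auto
  show ?thesis
  proof (rule that)
    show "A \<subseteq> S" "B \<subseteq> T" "lin_indpt B" using A B by (auto simp: maximal_def)
    show "span A = span S" "span B = span T"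
      using span_maximal_lin_indpt[OF SV A] span_maximal_lin_indpt[OF T(2) B(1)] by auto
    show "card A = vectorspace.dim K (span_vs S)" "card B = vectorspace.dim K (span_vs T)"
      using dim_span[OF SV finS A] dim_span[OF T(2) T(1) B(1)] by auto
  qed (fact B)
qed

lemma (in vectorspace) card_carrier_eq_power_card_basis:
  assumes "finite A" "basis A"
  shows "card (carrier V) = card (carrier K) ^ card A"
proof -
  have AV: "A \<subseteq> carrier V" using assms(2) by (simp add: basis_def)
  note uniq = basis_criterion[OF assms(1) AV, THEN iffD1, OF assms(2), rule_format]
  have "bij_betw (\<lambda>a. lincomb a A) (A \<rightarrow>\<^sub>E carrier K) (carrier V)"
  proof (rule bij_betw_imageI)
    have cl: "lincomb a A \<in> carrier V" if "a \<in> A \<rightarrow>\<^sub>E carrier K" for a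
      using that AV by (intro lincomb_closed) auto
    then show "inj_on (\<lambda>a. lincomb a A) (A \<rightarrow>\<^sub>E carrier K)"
      using uniq by (intro inj_onI) metis
    show "(\<lambda>a. lincomb a A) ` (A \<rightarrow>\<^sub>E carrier K) = carrier V"
      using cl uniq by blast
  qed
  from bij_betw_same_card[OF this] show ?thesis using assms(1) by (simp add: card_PiE)
qed

lemma (in vectorspace) fin_dim_of_finite_carrier: "finite (carrier V) \<Longrightarrow> fin_dim"
  unfolding fin_dim_def
  using in_own_span[of "carrier V"] span_is_subset2[of "carrier V"]
  by (intro exI[of _ "carrier V"]) auto

text \<open>Lets dimensions be read off cardinalities, both for vectors over \<open>K\<close> and
  for subspaces over the base field.\<close>

lemma (in vectorspace) card_carrier_eq_power_dim:
  assumes "finite (carrier V)"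
  shows "card (carrier V) = card (carrier K) ^ dim"
proof -
  obtain A where "finite A" "basis A"
    using finite_basis_exists[OF fin_dim_of_finite_carrier[OF assms]] by blast
  then show ?thesis using card_carrier_eq_power_card_basis dim_basis by simp
qed

section \<open>Linear algebra over a subfield compared with the whole field\<close>

context
  fixes K :: "'b::field set" and k :: nat
  assumes K: "subfield K (class_ring :: 'b ring)"
begin

interpretation F: field "subfield_ring K" by (rule field_subfield_ring[OF K])
interpretation V: vectorspace "subfield_ring K" "subfield_vec K k" by (rule vectorspace_subfield_vec[OF K])
interpretation L: vec_space "TYPE('b)" k .

lemma subfield_closed:
  "0 \<in> K" "1 \<in> K" "a \<in> K \<Longrightarrow> b \<in> K \<Longrightarrow> a + b \<in> K" "a \<in> K \<Longrightarrow> b \<in> K \<Longrightarrow> a * b \<in> K"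
  using F.zero_closed F.one_closed F.a_closed[of a b] F.m_closed[of a b]
  by (auto simp: subfield_ring_def)

lemma subfield_sum_closed: "(\<And>i. i \<in> I \<Longrightarrow> f i \<in> K) \<Longrightarrow> (\<Sum>i\<in>I. f i) \<in> K"
  by (induction I rule: infinite_finite_induct) (auto simp: subfield_closed)

lemma carrier_subfield_vec:
  "v \<in> carrier (subfield_vec K k) \<longleftrightarrow> v \<in> carrier_vec k \<and> (\<forall>i<k. vec_index v i \<in> K)"
  by (simp add: subfield_vec_def)

text \<open>\<open>V.span\<close> takes coefficients in \<open>K\<close>, \<open>L.span\<close> in
  the whole field. The latter, cut down to vectors with entries in \<open>K\<close>, is a submodule
  over \<open>K\<close> that contains \<open>S\<close>.\<close>

lemma span_subfield_vec_subset:
  assumes S: "S \<subseteq> carrier (subfield_vec K k)"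
  shows "V.span S \<subseteq> L.span S"
proof -
  have SL: "S \<subseteq> carrier_vec k" using S by (auto simp: carrier_subfield_vec)
  interpret W: submodule "class_ring :: 'b ring" "L.span S" "module_vec TYPE('b) k"
    using L.span_is_submodule[of S] SL by simp
  have "submodule (subfield_ring K) (L.span S \<inter> carrier (subfield_vec K k)) (subfield_vec K k)"
  proof (rule submodule.intro)
    show "Module.module (subfield_ring K) (subfield_vec K k)" by (rule V.module_axioms)
    fix v w assume vw: "v \<in> L.span S \<inter> carrier (subfield_vec K k)" "w \<in> L.span S \<inter> carrier (subfield_vec K k)"
    then have "v + w \<in> L.span S" using W.m_closed[of v w] by (simp add: module_vec_simps)
    then show "v \<oplus>\<^bsub>subfield_vec K k\<^esub> w \<in> L.span S \<inter> carrier (subfield_vec K k)"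
      using V.a_closed[of v w] vw by (simp add: subfield_vec_def module_vec_simps)
  next
    show "\<zero>\<^bsub>subfield_vec K k\<^esub> \<in> L.span S \<inter> carrier (subfield_vec K k)"
      using W.zero_closed V.M.zero_closed by (simp add: subfield_vec_def module_vec_simps)
  next
    fix c v assume cv: "c \<in> carrier (subfield_ring K)" "v \<in> L.span S \<inter> carrier (subfield_vec K k)"
    then have "c \<cdot>\<^sub>v v \<in> L.span S" using W.smult_closed[of c v] by (simp add: module_vec_simps)
    then show "c \<odot>\<^bsub>subfield_vec K k\<^esub> v \<in> L.span S \<inter> carrier (subfield_vec K k)"
      using V.smult_closed[of c v] cv by (simp add: subfield_vec_def module_vec_simps)
  qed simp
  moreover have "S \<subseteq> L.span S \<inter> carrier (subfield_vec K k)" using S L.in_own_span[of S] SL by simp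
  ultimately show ?thesis using V.span_is_subset by blast
qed

text \<open>The columns with index in \<open>I\<close> are replaced by a basis \<open>D\<close> of
  the \<open>K\<close>-span of \<open>S\<close>. Together with the remaining columns,
  \<open>D\<close> still spans everything over the whole field, so \<open>k\<close> is at most
  \<open>card D + (k - card I)\<close>.\<close>

lemma card_cols_le_dim:
  assumes A: "A \<in> carrier_mat k k" "det A \<noteq> 0"
    and S: "finite S" "S \<subseteq> carrier (subfield_vec K k)"
    and I: "I \<subseteq> {..<k}" "\<And>i. i \<in> I \<Longrightarrow> col A i \<in> S"
  shows "card I \<le> vectorspace.dim (subfield_ring K) (V.span_vs S)"
proof -
  obtain D D' where "D \<subseteq> D'" and D1: "D \<subseteq> S" and "D' \<subseteq> S" "V.lin_indpt D'"
    and D2: "V.span D = V.span S" and "V.span D' = V.span S"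
    and D3: "card D = vectorspace.dim (subfield_ring K) (V.span_vs S)"
    and "card D' = vectorspace.dim (subfield_ring K) (V.span_vs S)"
    by (rule V.nested_bases[OF S order_refl])
  note D = D1 D2 D3
  have SL: "S \<subseteq> carrier_vec k" using S by (auto simp: carrier_subfield_vec)
  have finD: "finite D" using D(1) S(1) by (rule finite_subset)
  have SD: "S \<subseteq> L.span D"
    using V.in_own_span[OF S(2)] D span_subfield_vec_subset[of D] S(2) by blast
  define C where "C = D \<union> col A ` ({..<k} - I)"
  have cols: "set (cols A) = col A ` {..<k}"
    using A by (auto simp: cols_def)
  have colsL: "set (cols A) \<subseteq> carrier_vec k" using A(1) cols_dim by blast
  have CL: "C \<subseteq> carrier_vec k" using D(1) SL A(1) by (auto simp: C_def)
  have "set (cols A) \<subseteq> L.span C"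
  proof
    fix v assume "v \<in> set (cols A)"
    then obtain i where i: "i < k" "v = col A i" unfolding cols by auto
    show "v \<in> L.span C"
    proof (cases "i \<in> I")
      case True
      then have "v \<in> L.span D" using I(2) SD i by blast
      then show ?thesis using L.span_is_monotone[of D C] by (auto simp: C_def)
    next
      case False
      then show ?thesis using i L.in_own_span[of C] CL by (auto simp: C_def)
    qed
  qed
  moreover obtain B' B where "B' \<subseteq> B" "B' \<subseteq> set (cols A)" and B1: "B \<subseteq> set (cols A)"
    and B2: "L.lin_indpt B" and "L.span B' = L.span (set (cols A))" "L.span B = L.span (set (cols A))"
    "card B' = vectorspace.dim class_ring (L.span_vs (set (cols A)))"
    and B3: "card B = vectorspace.dim class_ring (L.span_vs (set (cols A)))"
    by (rule L.nested_bases[of "set (cols A)" "set (cols A)"]) (use colsL in auto)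
  note B = B1 B2 B3
  ultimately have "B \<subseteq> L.span C" by blast
  have "card B = k" using B(3) L.det_rank_iff[OF A(1)] A(2) by (simp add: L.rank_def)
  have "finite B" using B(1) finite_subset by blast
  have finC: "finite C" using finD by (simp add: C_def)
  \<comment> \<open>Steinitz exchange: the independent set \<open>B\<close> lies in the span of
    \<open>C\<close>.\<close>
  have "int (card B) \<le> int (card C)"
    using L.replacement[OF \<open>finite B\<close> finC _ B(2) \<open>B \<subseteq> L.span C\<close>] CL by auto
  moreover have "card C \<le> card D + (k - card I)"
  proof -
    have "card C \<le> card D + card (col A ` ({..<k} - I))" unfolding C_def by (rule card_Un_le)
    also have "card (col A ` ({..<k} - I)) \<le> card ({..<k} - I)" by (rule card_image_le) simp
    also have "card ({..<k} - I) = k - card I" using I(1) finite_subset by (subst card_Diff_subset) auto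
    finally show ?thesis by simp
  qed
  moreover have "card I \<le> k" using card_mono[OF _ I(1)] by simp
  ultimately show ?thesis using D(3) \<open>card B = k\<close> by simp
qed

lemma card_carrier_subfield_vec:
  assumes "finite K"
  shows "finite (carrier (subfield_vec K k))" and "card (carrier (subfield_vec K k)) = card K ^ k"
proof -
  have *: "bij_betw (vec k) ({..<k} \<rightarrow>\<^sub>E K) (carrier (subfield_vec K k))"
  proof (rule bij_betw_imageI)
    show "inj_on (vec k) ({..<k} \<rightarrow>\<^sub>E K)"
    proof (rule inj_onI)
      fix f g assume fg: "f \<in> {..<k} \<rightarrow>\<^sub>E K" "g \<in> {..<k} \<rightarrow>\<^sub>E K" and eq: "vec k f = vec k g"
      have "f i = g i" if "i \<in> {..<k}" for i
        using arg_cong[OF eq, of "\<lambda>v. vec_index v i"] that by simp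
      then show "f = g" by (rule PiE_ext[OF fg])
    qed
    show "vec k ` ({..<k} \<rightarrow>\<^sub>E K) = carrier (subfield_vec K k)"
    proof (intro equalityI subsetI)
      fix v assume v: "v \<in> carrier (subfield_vec K k)"
      show "v \<in> vec k ` ({..<k} \<rightarrow>\<^sub>E K)"
      proof (rule image_eqI)
        show "v = vec k (restrict (vec_index v) {..<k})"
          using v unfolding carrier_subfield_vec by (intro eq_vecI) auto
        show "restrict (vec_index v) {..<k} \<in> {..<k} \<rightarrow>\<^sub>E K"
          using v unfolding carrier_subfield_vec by auto
      qed
    next
      fix v assume "v \<in> vec k ` ({..<k} \<rightarrow>\<^sub>E K)"
      then obtain f where f: "f \<in> {..<k} \<rightarrow>\<^sub>E K" "v = vec k f" by (rule imageE)
      then show "v \<in> carrier (subfield_vec K k)"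
        unfolding carrier_subfield_vec using PiE_mem[OF f(1)] by simp
    qed
  qed
  have "finite ({..<k} \<rightarrow>\<^sub>E K)" using assms by (intro finite_PiE) auto
  then show "finite (carrier (subfield_vec K k))" using bij_betw_finite[OF *] by (simp only:)
  show "card (carrier (subfield_vec K k)) = card K ^ k"
    using bij_betw_same_card[OF *] by (simp add: card_PiE)
qed

text \<open>The \<open>k\<close> independent columns form a basis over \<open>K\<close>, so they
  generate the unit vectors. The same combinations are available over the whole field, hence the
  columns span there too and the rank is full.\<close>

lemma det_nonzero_of_subfield_lin_indpt:
  assumes "finite K" and A: "A \<in> carrier_mat k k"
    and li: "V.lin_indpt (set (cols A))" "set (cols A) \<subseteq> carrier (subfield_vec K k)" "card (set (cols A)) = k"
  shows "det A \<noteq> 0"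
proof -
  have colsL: "set (cols A) \<subseteq> carrier_vec k" using A cols_dim by blast
  have "card {0, 1 :: 'b} \<le> card K" using subfield_closed \<open>finite K\<close> by (intro card_mono) auto
  then have K2: "1 < card K" by simp
  \<comment> \<open>The dimension is found by counting the vectors in two ways;
    \<open>1 < card K\<close> then allows the exponents to be compared.\<close>
  have "card K ^ k = card K ^ V.dim"
    using V.card_carrier_eq_power_dim card_carrier_subfield_vec[OF \<open>finite K\<close>]
    by (simp add: subfield_ring_def)
  then have "V.dim = k" using K2 by (metis power_inject_exp)
  moreover have "V.fin_dim"
    using card_carrier_subfield_vec(1)[OF \<open>finite K\<close>] by (rule V.fin_dim_of_finite_carrier)
  ultimately have "V.basis (set (cols A))" using V.dim_li_is_basis[of "set (cols A)"] li by simp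
  then have gen: "V.span (set (cols A)) = carrier (subfield_vec K k)" by (simp add: V.basis_def)
  have "unit_vec k i \<in> carrier (subfield_vec K k)" for i
    by (auto simp: carrier_subfield_vec unit_vec_def subfield_closed)
  then have "set (unit_vecs k) \<subseteq> L.span (set (cols A))"
    using gen span_subfield_vec_subset[OF li(2)] by (auto simp: unit_vecs_def)
  then have "L.span (set (unit_vecs k)) \<subseteq> L.span (set (cols A))"
    using colsL by (intro L.span_is_subset L.span_is_submodule) auto
  then have "L.span (set (cols A)) = carrier_vec k"
    using L.span_unit_vecs_is_carrier L.span_is_subset2[of "set (cols A)"] colsL by auto
  moreover have "module_vec TYPE('b) k\<lparr>carrier := carrier_vec k\<rparr> = module_vec TYPE('b) k"
    by (simp add: module_vec_def)
  ultimately have "L.rank A = L.dim" unfolding L.rank_def by (simp only:)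
  then show ?thesis using L.det_rank_iff[OF A] L.dim_is_n by simp
qed

end


section \<open>The number of representable \<open>q\<close>-matroids\<close>

text \<open>Translates the products in the definition of representability into images of the rows of
  \<open>Y\<close> under the linear map given by \<open>G\<close>.\<close>

lemma cols_mult_transpose_mat_of_rows:
  assumes G: "G \<in> carrier_mat k n" and ws: "set ws \<subseteq> carrier_vec n"
  shows "cols (G * (map_mat h (mat_of_rows n ws))\<^sup>T) = map (\<lambda>w. G *\<^sub>v map_vec h w) ws"
proof (rule nth_equalityI)
  show "length (cols (G * (map_mat h (mat_of_rows n ws))\<^sup>T)) = length (map (\<lambda>w. G *\<^sub>v map_vec h w) ws)"
    by simp
  fix i assume "i < length (cols (G * (map_mat h (mat_of_rows n ws))\<^sup>T))"
  then have i: "i < length ws" by simp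
  then have wsi: "ws ! i \<in> carrier_vec n" using ws nth_mem by blast
  let ?Y = "map_mat h (mat_of_rows n ws)"
  have Y: "?Y\<^sup>T \<in> carrier_mat n (length ws)" by simp
  have "cols (G * ?Y\<^sup>T) ! i = col (G * ?Y\<^sup>T) i" using i by simp
  also have "\<dots> = G *\<^sub>v col ?Y\<^sup>T i" by (rule col_mult2[OF G Y i])
  also have "col ?Y\<^sup>T i = map_vec h (ws ! i)"
    using i wsi by (intro eq_vecI) (auto simp: mat_of_rows_index)
  finally show "cols (G * ?Y\<^sup>T) ! i = map (\<lambda>w. G *\<^sub>v map_vec h w) ws ! i" using i by simp
qed

lemma finite_carrier_vec: "finite (carrier_vec n :: 'a::finite vec set)"
proof -
  have "carrier_vec n \<subseteq> vec n ` ({..<n} \<rightarrow>\<^sub>E (UNIV :: 'a set))"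
  proof
    fix v :: "'a vec" assume v: "v \<in> carrier_vec n"
    show "v \<in> vec n ` ({..<n} \<rightarrow>\<^sub>E UNIV)"
    proof (rule image_eqI)
      show "v = vec n (restrict (vec_index v) {..<n})" using v by (intro eq_vecI) auto
    qed simp
  qed
  then show ?thesis by (rule finite_subset) (intro finite_imageI finite_PiE; simp)
qed

lemma card_carrier_mat_le:
  "finite (carrier_mat k n :: 'a::finite mat set)"
  "card (carrier_mat k n :: 'a::finite mat set) \<le> CARD('a) ^ (k * n)"
proof -
  let ?V = "{..<k} \<times> {..<n} :: (nat \<times> nat) set"
  let ?P = "?V \<rightarrow>\<^sub>E (UNIV :: 'a set)"
  have sub: "carrier_mat k n \<subseteq> mat k n ` ?P"
  proof
    fix A :: "'a mat" assume A: "A \<in> carrier_mat k n"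
    show "A \<in> mat k n ` ?P"
    proof (rule image_eqI)
      show "A = mat k n (restrict (\<lambda>p. A $$ p) ?V)" using A by (intro eq_matI) auto
    qed simp
  qed
  have fin: "finite ?P" by (intro finite_PiE) simp_all
  then show "finite (carrier_mat k n :: 'a mat set)" using finite_subset[OF sub] by simp
  have "card (carrier_mat k n :: 'a mat set) \<le> card (mat k n ` ?P)"
    using sub fin by (intro card_mono) simp_all
  also have "\<dots> \<le> card ?P" by (rule card_image_le[OF fin])
  also have "\<dots> = CARD('a) ^ (k * n)" by (simp add: card_PiE)
  finally show "card (carrier_mat k n :: 'a mat set) \<le> CARD('a) ^ (k * n)" .
qed

lemma (in vec_space) subspaces_subset_carrier: "W \<in> subspaces \<Longrightarrow> W \<subseteq> carrier_vec n"
  by (auto simp: subspaces_def VectorSpace.subspace_def submodule_def module_vec_simps)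

lemma (in vec_space) carrier_in_subspaces: "carrier_vec n \<in> subspaces"
  using span_is_subspace[of "set (unit_vecs n)"] unit_vecs_carrier[of n, where ?'a = 'a]
  by (simp add: subspaces_def span_unit_vecs_is_carrier)

lemma (in vec_space) subspace_dim_carrier: "subspace_dim (carrier_vec n) = n"
proof -
  have "vs (carrier_vec n) = V" by (simp add: module_vec_def)
  then show ?thesis unfolding subspace_dim_def by (simp only: dim_is_n)
qed

section \<open>The rank function given by a representing matrix\<close>

context
  fixes K :: "'a::{finite,field} alg_closure set" and \<rho> :: "'a vec set \<Rightarrow> nat" and k n :: nat
    and G :: "'a alg_closure mat"
  assumes K: "subfield K class_ring" and finK: "finite K" and ac: "range to_ac \<subseteq> K"
    and G: "G \<in> carrier_mat k n" "elements_mat G \<subseteq> K"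
    and rk: "\<rho> (carrier_vec n) = k"
      "\<forall>W\<in>vec_space.subspaces n. \<forall>l. \<forall>Y\<in>carrier_mat l n.
        vec_space.row_space n Y = W \<longrightarrow> \<rho> W = rank_over K (G * (map_mat to_ac Y)\<^sup>T)"
begin

interpretation E: vec_space "TYPE('a)" n .
interpretation V: vectorspace "subfield_ring K" "subfield_vec K k" by (rule vectorspace_subfield_vec[OF K])

definition image_vec :: "'a vec \<Rightarrow> 'a alg_closure vec" where
  "image_vec w = G *\<^sub>v map_vec to_ac w"

lemma image_vec_carrier: "w \<in> carrier_vec n \<Longrightarrow> image_vec w \<in> carrier (subfield_vec K k)"
proof -
  assume w: "w \<in> carrier_vec n"
  have "vec_index (image_vec w) i \<in> K" if i: "i < k" for i
  proof -
    have "G $$ (i, j) * to_ac (vec_index w j) \<in> K" if "j < n" for j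
    proof (rule subfield_closed(4)[OF K])
      show "G $$ (i, j) \<in> K" using elements_matI[OF G(1) i that refl] G(2) by blast
      show "to_ac (vec_index w j) \<in> K" using ac by blast
    qed
    then have "(\<Sum>j\<in>{0..<n}. G $$ (i, j) * to_ac (vec_index w j)) \<in> K"
      by (intro subfield_sum_closed[OF K]) simp
    moreover have "vec_index (image_vec w) i = (\<Sum>j\<in>{0..<n}. G $$ (i, j) * to_ac (vec_index w j))"
      using i G w by (auto simp: image_vec_def scalar_prod_def intro!: sum.cong)
    ultimately show ?thesis by simp
  qed
  moreover have "image_vec w \<in> carrier_vec k"
    unfolding image_vec_def using G(1) by (rule mult_mat_vec_carrier) (use w in simp)
  ultimately show ?thesis by (simp add: carrier_subfield_vec[OF K])
qed

text \<open>As \<open>W\<close> is finite, all its vectors can be taken as the rows of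
  \<open>Y\<close>; the columns of the product are then exactly the image of
  \<open>W\<close>.\<close>

lemma rank_eq_dim_image:
  assumes W: "W \<in> E.subspaces"
  shows "\<rho> W = vectorspace.dim (subfield_ring K) (V.span_vs (image_vec ` W))"
proof -
  have WE: "W \<subseteq> carrier_vec n" by (rule E.subspaces_subset_carrier[OF W])
  then obtain ws where ws: "set ws = W" using finite_list finite_subset[OF WE finite_carrier_vec] by auto
  let ?Y = "mat_of_rows n ws"
  have "E.row_space ?Y = W"
  proof -
    have "rows ?Y = ws" using ws WE by (intro rows_mat_of_rows) simp
    then have "E.row_space ?Y = E.span W" by (simp add: E.row_space_def ws)
    also have "\<dots> = W"
      using W E.in_own_span[of W] E.span_is_subset[of W W] WE
      by (auto simp: E.subspaces_def VectorSpace.subspace_def)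
    finally show ?thesis .
  qed
  moreover have "?Y \<in> carrier_mat (length ws) n" by simp
  ultimately have "\<rho> W = rank_over K (G * (map_mat to_ac ?Y)\<^sup>T)" using rk(2) W by blast
  moreover have "set (cols (G * (map_mat to_ac ?Y)\<^sup>T)) = image_vec ` W"
    using cols_mult_transpose_mat_of_rows[OF G(1), of ws to_ac] ws WE by (simp add: image_vec_def)
  ultimately show ?thesis using G(1) by (simp add: rank_over_def Let_def)
qed

text \<open>A row of \<open>Y\<close> in \<open>W\<close> becomes a column of the product in the
  image of \<open>W\<close>. By \<open>card_cols_le_dim\<close>, a nonsingular matrix has at most as
  many such columns as the dimension of the \<open>K\<close>-span of that image.\<close>

lemma card_rows_in_subspace_le:
  assumes Y: "Y \<in> carrier_mat k n" "det (G * (map_mat to_ac Y)\<^sup>T) \<noteq> 0" and W: "W \<in> E.subspaces"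
  shows "card {i. i < k \<and> row Y i \<in> W} \<le> \<rho> W"
proof -
  have WE: "W \<subseteq> carrier_vec n" by (rule E.subspaces_subset_carrier[OF W])
  have "set (rows Y) \<subseteq> carrier_vec n" using Y(1) by (auto simp: rows_def)
  from cols_mult_transpose_mat_of_rows[OF G(1) this, of to_ac]
  have cols: "cols (G * (map_mat to_ac Y)\<^sup>T) = map image_vec (rows Y)"
    using mat_of_rows_rows[of Y] Y(1) by (simp add: image_vec_def[abs_def])
  have "col (G * (map_mat to_ac Y)\<^sup>T) i \<in> image_vec ` W" if "i < k" "row Y i \<in> W" for i
  proof -
    have "col (G * (map_mat to_ac Y)\<^sup>T) i = cols (G * (map_mat to_ac Y)\<^sup>T) ! i"
      using that Y(1) by simp
    also have "\<dots> = image_vec (row Y i)" unfolding cols using that Y(1) by simp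
    finally show ?thesis using that by simp
  qed
  moreover have "finite (image_vec ` W)" using finite_subset[OF WE finite_carrier_vec] by simp
  moreover have "image_vec ` W \<subseteq> carrier (subfield_vec K k)" using WE image_vec_carrier by blast
  moreover have "G * (map_mat to_ac Y)\<^sup>T \<in> carrier_mat k k" using G(1) Y(1) by simp
  ultimately show ?thesis
    unfolding rank_eq_dim_image[OF W] using Y(2)
    by (intro card_cols_le_dim[OF K]) auto
qed

text \<open>The bound of \<open>card_rows_in_subspace_le\<close> is attained: a basis for the image
  of \<open>W\<close> is extended to one for the image of the whole space, and preimages of the
  basis vectors serve as the rows of \<open>Y\<close>.\<close>

lemma ex_nonsingular_rows_in_subspace:
  assumes W: "W \<in> E.subspaces"
  shows "\<exists>Y\<in>carrier_mat k n. det (G * (map_mat to_ac Y)\<^sup>T) \<noteq> 0 \<and> \<rho> W \<le> card {i. i < k \<and> row Y i \<in> W}"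
proof -
  have WE: "W \<subseteq> carrier_vec n" by (rule E.subspaces_subset_carrier[OF W])
  have fin: "finite (image_vec ` carrier_vec n)" using finite_carrier_vec by (rule finite_imageI)
  have carr: "image_vec ` carrier_vec n \<subseteq> carrier (subfield_vec K k)" using image_vec_carrier by blast
  have sub: "image_vec ` W \<subseteq> image_vec ` carrier_vec n" using WE by (rule image_mono)
  obtain A B where AB: "A \<subseteq> B" and A: "A \<subseteq> image_vec ` W" and B: "B \<subseteq> image_vec ` carrier_vec n"
    and li: "V.lin_indpt B" and "V.span A = V.span (image_vec ` W)"
      "V.span B = V.span (image_vec ` carrier_vec n)"
    and cA: "card A = vectorspace.dim (subfield_ring K) (V.span_vs (image_vec ` W))"
    and cB: "card B = vectorspace.dim (subfield_ring K) (V.span_vs (image_vec ` carrier_vec n))"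
    by (rule V.nested_bases[OF fin carr sub])
  have cardA: "card A = \<rho> W" unfolding cA by (rule rank_eq_dim_image[OF W, symmetric])
  \<comment> \<open>The whole space has rank \<open>k\<close>, so the basis has exactly as many
    vectors as \<open>Y\<close> needs rows.\<close>
  have cardB: "card B = k" unfolding cB rank_eq_dim_image[OF E.carrier_in_subspaces, symmetric] by (rule rk(1))
  have finB: "finite B" using B fin by (rule finite_subset)
  then have finA: "finite A" using AB finite_subset by blast
  obtain xs where xs: "set xs = A" "distinct xs" using finite_distinct_list[OF finA] by blast
  obtain ys where ys: "set ys = B - A" "distinct ys" using finite_distinct_list[of "B - A"] finB by blast
  \<comment> \<open>Preimages of the vectors in \<open>A\<close> are taken inside \<open>W\<close>;
    those of the remaining basis vectors, given by \<open>g\<close>, may lie anywhere.\<close>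
  obtain f where f: "\<And>b. b \<in> A \<Longrightarrow> f b \<in> W \<and> image_vec (f b) = b"
  proof -
    have "\<exists>w. w \<in> W \<and> image_vec w = b" if "b \<in> A" for b using that A by blast
    then show ?thesis by (intro that[of "\<lambda>b. SOME w. w \<in> W \<and> image_vec w = b"]) (rule someI_ex)
  qed
  obtain g where g: "\<And>b. b \<in> B \<Longrightarrow> g b \<in> carrier_vec n \<and> image_vec (g b) = b"
  proof -
    have "\<exists>w. w \<in> carrier_vec n \<and> image_vec w = b" if "b \<in> B" for b using that B by blast
    then show ?thesis by (intro that[of "\<lambda>b. SOME w. w \<in> carrier_vec n \<and> image_vec w = b"]) (rule someI_ex)
  qed
  \<comment> \<open>The preimages from \<open>W\<close> come first, so the rows with index below
    \<open>length xs\<close> lie in \<open>W\<close>.\<close>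
  define ws where "ws = map f xs @ map g ys"
  define Y where "Y = mat_of_rows n ws"
  have wsE: "set ws \<subseteq> carrier_vec n" using f g xs ys WE by (auto simp: ws_def)
  have img: "map image_vec ws = xs @ ys" using f g xs ys by (auto simp: ws_def intro!: map_idI)
  have "distinct (xs @ ys)" "set (xs @ ys) = B" using xs ys AB by auto
  then have len: "length ws = k" using cardB distinct_card[of "xs @ ys"] by (simp add: ws_def)
  have Y: "Y \<in> carrier_mat k n" using mat_of_rows_carrier(1)[of n ws] by (simp add: Y_def len)
  have cols: "cols (G * (map_mat to_ac Y)\<^sup>T) = xs @ ys"
    using cols_mult_transpose_mat_of_rows[OF G(1) wsE, of to_ac] img by (simp add: image_vec_def[abs_def] Y_def)
  have "det (G * (map_mat to_ac Y)\<^sup>T) \<noteq> 0"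
  proof (rule det_nonzero_of_subfield_lin_indpt[OF K finK])
    show "G * (map_mat to_ac Y)\<^sup>T \<in> carrier_mat k k" using G(1) Y by simp
    show "V.lin_indpt (set (cols (G * (map_mat to_ac Y)\<^sup>T)))"
      "set (cols (G * (map_mat to_ac Y)\<^sup>T)) \<subseteq> carrier (subfield_vec K k)"
      "card (set (cols (G * (map_mat to_ac Y)\<^sup>T))) = k"
      unfolding cols \<open>set (xs @ ys) = B\<close> using li B carr cardB by blast+
  qed
  moreover have "\<rho> W \<le> card {i. i < k \<and> row Y i \<in> W}"
  proof -
    have "row Y i \<in> W" if "i < length xs" for i
    proof -
      have "row Y i = ws ! i" using that wsE nth_mem[of i ws] by (auto simp: Y_def ws_def)
      also have "\<dots> = f (xs ! i)" using that by (simp add: ws_def nth_append)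
      finally show ?thesis using f[of "xs ! i"] xs(1) nth_mem[OF that] by simp
    qed
    then have "{..<length xs} \<subseteq> {i. i < k \<and> row Y i \<in> W}" using len by (auto simp: ws_def)
    then have "card {..<length xs} \<le> card {i. i < k \<and> row Y i \<in> W}" by (intro card_mono) auto
    then show ?thesis using distinct_card[OF xs(2)] xs(1) cardA by simp
  qed
  ultimately show ?thesis using Y by blast
qed

end

section \<open>Counting representable \<open>q\<close>-matroids by their patterns\<close>

text \<open>The zero pattern, at the point \<open>G\<close>, of polynomials indexed by the matrices
  \<open>Y\<close> over the base field. The entries of \<open>G\<close> may lie anywhere in the
  algebraic closure, so no extension degree enters the count.\<close>

definition nonsingular_pattern :: "nat \<Rightarrow> nat \<Rightarrow> 'a::{finite,field} alg_closure mat \<Rightarrow> 'a mat set" where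
  "nonsingular_pattern k n G = {Y \<in> carrier_mat k n. det (G * (map_mat to_ac Y)\<^sup>T) \<noteq> 0}"

text \<open>This is \<open>card_zero_patterns_le\<close> with the \<open>k * n\<close> entries of
  \<open>G\<close> as variables and one polynomial with degree bound \<open>k\<close> for each of
  the at most \<open>CARD('a) ^ (k * n)\<close> matrices \<open>Y\<close>.\<close>

lemma card_nonsingular_patterns_le:
  "finite (nonsingular_pattern k n ` (carrier_mat k n :: 'a::{finite,field} alg_closure mat set))"
  "card (nonsingular_pattern k n ` (carrier_mat k n :: 'a alg_closure mat set))
    \<le> (k * CARD('a) ^ (k * n) + 1) ^ (k * n)"
proof -
  let ?I = "carrier_mat k n :: 'a mat set"
  let ?V = "{..<k} \<times> {..<n} :: (nat \<times> nat) set"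
  define f where "f Y x = det (mat k n x * (map_mat to_ac Y)\<^sup>T)"
    for Y :: "'a mat" and x :: "nat \<times> nat \<Rightarrow> 'a alg_closure"
  have f: "f Y \<in> poly_funs ?V k" if "Y \<in> ?I" for Y
    unfolding f_def by (rule det_mat_mult_in_poly_funs) (use that in simp)
  let ?P = "range (\<lambda>x. {Y \<in> ?I. f Y x \<noteq> 0})"
  have sub: "nonsingular_pattern k n ` carrier_mat k n \<subseteq> ?P"
  proof
    fix S assume "S \<in> nonsingular_pattern k n ` (carrier_mat k n :: 'a alg_closure mat set)"
    then obtain G where G: "G \<in> carrier_mat k n" "S = nonsingular_pattern k n G" by (rule imageE)
    have "G = mat k n (\<lambda>p. G $$ p)" using G(1) by (intro eq_matI) auto
    then have "S = {Y \<in> ?I. f Y (\<lambda>p. G $$ p) \<noteq> 0}"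
      unfolding G(2) nonsingular_pattern_def f_def by simp
    then show "S \<in> ?P" by blast
  qed
  have fin: "finite ?P"
    by (rule finite_subset[of _ "Pow ?I"]) (use card_carrier_mat_le(1)[where ?'a = 'a] in auto)
  show "finite (nonsingular_pattern k n ` (carrier_mat k n :: 'a alg_closure mat set))"
    using sub fin by (rule finite_subset)
  have "card (nonsingular_pattern k n ` (carrier_mat k n :: 'a alg_closure mat set)) \<le> card ?P"
    using fin sub by (rule card_mono)
  also have "\<dots> \<le> (k * card ?I + 1) ^ card ?V"
    by (rule card_zero_patterns_le) (use f card_carrier_mat_le(1)[where ?'a = 'a] in auto)
  also have "\<dots> \<le> (k * CARD('a) ^ (k * n) + 1) ^ card ?V"
    using card_carrier_mat_le(2)[where ?'a = 'a] by (intro power_mono add_right_mono mult_left_mono) auto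
  finally show "card (nonsingular_pattern k n ` (carrier_mat k n :: 'a alg_closure mat set))
    \<le> (k * CARD('a) ^ (k * n) + 1) ^ (k * n)" by simp
qed

text \<open>Says that \<open>\<rho> W\<close> is a maximum of row counts over the pattern, split
  into bound and attainment. The field \<open>K\<close> no longer occurs, and \<open>G\<close>
  matters only through its pattern.\<close>

definition represents :: "nat \<Rightarrow> nat \<Rightarrow> 'a::{finite,field} alg_closure mat \<Rightarrow> ('a vec set \<Rightarrow> nat) \<Rightarrow> bool" where
  "represents k n G \<rho> \<longleftrightarrow> G \<in> carrier_mat k n \<and>
     (\<forall>W\<in>vec_space.subspaces n.
        (\<forall>Y\<in>nonsingular_pattern k n G. card {i. i < k \<and> row Y i \<in> W} \<le> \<rho> W) \<and>
        (\<exists>Y\<in>nonsingular_pattern k n G. \<rho> W \<le> card {i. i < k \<and> row Y i \<in> W}))"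

lemma representable_imp_represents:
  assumes "representable n \<rho>"
  shows "\<exists>G. represents (\<rho> (carrier_vec n)) n G \<rho>"
proof -
  from assms[unfolded representable_def]
  obtain m K k G where K: "subfield K class_ring" "range to_ac \<subseteq> K" "card K = CARD('a) ^ m"
    and k: "k = \<rho> (carrier_vec n)" and G: "G \<in> carrier_mat k n" "elements_mat G \<subseteq> K"
    and rk: "\<forall>W\<in>vec_space.subspaces n. \<forall>l. \<forall>Y\<in>carrier_mat l n.
      vec_space.row_space n Y = W \<longrightarrow> \<rho> W = rank_over K (G * (map_mat to_ac Y)\<^sup>T)"
    by (elim exE conjE) (rule that; assumption)
  \<comment> \<open>An infinite set has \<open>card\<close> 0, whereas \<open>CARD('a) ^ m\<close>
    is positive.\<close>
  have finK: "finite K" using K(3) card_ge_0_finite[of K] by simp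
  note rows = card_rows_in_subspace_le[OF K(1) finK K(2) G k[symmetric] rk]
    ex_nonsingular_rows_in_subspace[OF K(1) finK K(2) G k[symmetric] rk]
  have "represents k n G \<rho>"
    unfolding represents_def
  proof (intro conjI ballI)
    fix W :: "'a vec set" assume W: "W \<in> vec_space.subspaces n"
    show "card {i. i < k \<and> row Y i \<in> W} \<le> \<rho> W" if "Y \<in> nonsingular_pattern k n G" for Y
      using rows(1)[OF _ _ W] that unfolding nonsingular_pattern_def by simp
    show "\<exists>Y\<in>nonsingular_pattern k n G. \<rho> W \<le> card {i. i < k \<and> row Y i \<in> W}"
      using rows(2)[OF W] unfolding nonsingular_pattern_def by blast
  qed (rule G(1))
  then show ?thesis unfolding k by (rule exI)
qed

text \<open>Both values are the maximum of the same row counts over the same set of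
  matrices.\<close>

lemma represents_unique:
  assumes "represents k n G \<rho>" "represents k n G' \<rho>'"
    and "nonsingular_pattern k n G = nonsingular_pattern k n G'"
    and W: "W \<in> vec_space.subspaces n"
  shows "\<rho> W = \<rho>' W"
proof (rule antisym)
  have *: "\<sigma> W \<le> \<sigma>' W" if r: "represents k n H \<sigma>" "represents k n H' \<sigma>'"
    "nonsingular_pattern k n H = nonsingular_pattern k n H'" for H H' \<sigma> \<sigma>'
  proof -
    obtain Y where "Y \<in> nonsingular_pattern k n H" and le: "\<sigma> W \<le> card {i. i < k \<and> row Y i \<in> W}"
      using r(1) W unfolding represents_def by blast
    then have "Y \<in> nonsingular_pattern k n H'" using r(3) by simp
    then have "card {i. i < k \<and> row Y i \<in> W} \<le> \<sigma>' W"
      using r(2) W unfolding represents_def by blast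
    with le show ?thesis by (rule order_trans)
  qed
  show "\<rho> W \<le> \<rho>' W" by (rule *[OF assms(1,2,3)])
  show "\<rho>' W \<le> \<rho> W" by (rule *[OF assms(2,1) assms(3)[symmetric]])
qed

text \<open>Sending \<open>\<rho>\<close> to the pattern of a chosen representing matrix is
  injective: equal patterns force equal values on subspaces, and extensionality settles all other
  arguments.\<close>

lemma card_representable_rank_le:
  "card {\<rho> \<in> vec_space.q_matroids n. representable n \<rho> \<and> \<rho> (carrier_vec n :: 'a::{finite,field} vec set) = k}
    \<le> (k * CARD('a) ^ (k * n) + 1) ^ (k * n)"
proof -
  let ?R = "{\<rho> \<in> vec_space.q_matroids n. representable n \<rho> \<and> \<rho> (carrier_vec n :: 'a vec set) = k}"
  define G where "G \<rho> = (SOME G. represents k n G \<rho>)" for \<rho> :: "'a vec set \<Rightarrow> nat"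
  have G: "represents k n (G \<rho>) \<rho>" if "\<rho> \<in> ?R" for \<rho>
  proof -
    have "representable n \<rho>" "\<rho> (carrier_vec n) = k" using that by simp_all
    from representable_imp_represents[OF this(1)] show ?thesis
      unfolding \<open>\<rho> (carrier_vec n) = k\<close> G_def by (rule someI_ex)
  qed
  have inj: "inj_on (\<lambda>\<rho>. nonsingular_pattern k n (G \<rho>)) ?R"
  proof (rule inj_onI)
    fix \<rho> \<rho>' assume R: "\<rho> \<in> ?R" "\<rho>' \<in> ?R"
      and eq: "nonsingular_pattern k n (G \<rho>) = nonsingular_pattern k n (G \<rho>')"
    have ext: "\<rho> \<in> extensional (vec_space.subspaces n)" "\<rho>' \<in> extensional (vec_space.subspaces n)"
      using R by (auto simp: vec_space.q_matroids_def)
    show "\<rho> = \<rho>'"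
      by (rule extensionalityI[OF ext]) (rule represents_unique[OF G[OF R(1)] G[OF R(2)] eq])
  qed
  have "card ?R \<le> card (nonsingular_pattern k n ` (carrier_mat k n :: 'a alg_closure mat set))"
  proof (rule card_inj_on_le[OF inj])
    show "(\<lambda>\<rho>. nonsingular_pattern k n (G \<rho>)) ` ?R \<subseteq> nonsingular_pattern k n ` carrier_mat k n"
      using G unfolding represents_def by blast
  qed (rule card_nonsingular_patterns_le)
  also note card_nonsingular_patterns_le(2)
  finally show ?thesis .
qed

text \<open>The rank lies between 0 and \<open>n\<close>, whence the factor \<open>n + 1\<close>;
  the bound for each rank is at most the one for rank \<open>n\<close>.\<close>

lemma num_representable_le:
  "num_representable TYPE('a::{finite,field}) n \<le> (n + 1) * (n * CARD('a) ^ (n * n) + 1) ^ (n * n)"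
proof -
  let ?R = "\<lambda>k. {\<rho> \<in> vec_space.q_matroids n. representable n \<rho> \<and> \<rho> (carrier_vec n :: 'a vec set) = k}"
  interpret E: vec_space "TYPE('a)" n .
  have le: "\<rho> (carrier_vec n) \<le> n" if "\<rho> \<in> E.q_matroids" for \<rho>
  proof -
    have "\<rho> (carrier_vec n) \<le> E.subspace_dim (carrier_vec n)"
      using that E.carrier_in_subspaces unfolding E.q_matroids_def E.q_matroid_def by blast
    then show ?thesis unfolding E.subspace_dim_carrier .
  qed
  have "num_representable TYPE('a) n \<le> card (\<Union>k\<in>{..n}. ?R k)"
    unfolding num_representable_def
  proof (rule card_mono)
    show "finite (\<Union>k\<in>{..n}. ?R k)"
      by (rule finite_subset[OF _ finite_q_matroids[of n]]) blast
    show "{\<rho> \<in> E.q_matroids. representable n \<rho>} \<subseteq> (\<Union>k\<in>{..n}. ?R k)" using le by blast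
  qed
  also have "\<dots> \<le> (\<Sum>k\<le>n. card (?R k))" by (rule card_UN_le) simp
  also have "\<dots> \<le> (\<Sum>k\<le>n. (n * CARD('a) ^ (n * n) + 1) ^ (n * n))"
  proof (rule sum_mono)
    fix k assume "k \<in> {..n}"
    then have k: "k \<le> n" by simp
    have "card (?R k) \<le> (k * CARD('a) ^ (k * n) + 1) ^ (k * n)" by (rule card_representable_rank_le)
    also have "\<dots> \<le> (n * CARD('a) ^ (n * n) + 1) ^ (k * n)"
      using k by (intro power_mono add_right_mono mult_mono power_increasing) auto
    also have "\<dots> \<le> (n * CARD('a) ^ (n * n) + 1) ^ (n * n)"
      using k by (intro power_increasing) auto
    finally show "card (?R k) \<le> (n * CARD('a) ^ (n * n) + 1) ^ (n * n)" .
  qed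
  finally show ?thesis by simp
qed


section \<open>\<open>q\<close>-matroids from partial spreads\<close>

locale finite_vec_space = vec_space f_ty n for f_ty :: "'a::{finite,field} itself" and n
begin

lemma subspace_iff:
  "W \<in> subspaces \<longleftrightarrow> W \<subseteq> carrier_vec n \<and> 0\<^sub>v n \<in> W \<and> (\<forall>v\<in>W. \<forall>w\<in>W. v + w \<in> W) \<and> (\<forall>c. \<forall>v\<in>W. c \<cdot>\<^sub>v v \<in> W)"
  by (simp add: subspaces_def VectorSpace.subspace_def submodule_def module_vec_simps
      vectorspace_axioms module_axioms) blast

lemma finite_subspace: "W \<in> subspaces \<Longrightarrow> finite W"
  using finite_subset[OF subspaces_subset_carrier finite_carrier_vec] .

lemma card_field_gt_1: "1 < CARD('a)"
proof -
  have "card {0, 1 :: 'a} \<le> CARD('a)" by (intro card_mono) auto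
  then show ?thesis by simp
qed

lemma card_subspace:
  assumes W: "W \<in> subspaces"
  shows "card W = CARD('a) ^ subspace_dim W"
proof -
  have "VectorSpace.subspace class_ring W V" using W by (simp add: subspaces_def)
  then interpret W: vectorspace class_ring "vs W" by (rule subspace_is_vs)
  show ?thesis using W.card_carrier_eq_power_dim finite_subspace[OF W] by (simp add: subspace_dim_def)
qed

lemma subspace_dim_strict_mono:
  assumes "A \<in> subspaces" "B \<in> subspaces" "A \<subset> B"
  shows "subspace_dim A < subspace_dim B"
proof -
  have "card A < card B" using assms finite_subspace by (intro psubset_card_mono) auto
  then show ?thesis using card_subspace[OF assms(1)] card_subspace[OF assms(2)] card_field_gt_1 by simp
qed

lemma zero_in_subspaces: "{0\<^sub>v n} \<in> subspaces"
  by (auto simp: subspace_iff)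

lemma subspace_dim_zero: "subspace_dim {0\<^sub>v n} = 0"
  using card_subspace[OF zero_in_subspaces] card_field_gt_1 by (cases "subspace_dim {0\<^sub>v n}") auto

lemma Int_in_subspaces: "A \<in> subspaces \<Longrightarrow> B \<in> subspaces \<Longrightarrow> A \<inter> B \<in> subspaces"
  by (auto simp: subspace_iff)

lemma subspace_sum_in_subspaces: "A \<in> subspaces \<Longrightarrow> B \<in> subspaces \<Longrightarrow> subspace_sum A B \<in> subspaces"
  using sum_is_subspace by (simp add: subspaces_def)

lemma subspace_sum_absorb:
  assumes "A \<in> subspaces" "B \<in> subspaces" "A \<subseteq> B"
  shows "subspace_sum A B = B" "subspace_sum B A = B"
proof -
  have AB: "VectorSpace.subspace class_ring A V" "VectorSpace.subspace class_ring B V"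
    using assms by (simp_all add: subspaces_def)
  show *: "subspace_sum A B = B"
  proof
    show "subspace_sum A B \<subseteq> B" using vsum_is_minimal[OF AB AB(2)] assms(3) by blast
    show "B \<subseteq> subspace_sum A B" using in_sum_vs[OF AB(2,1)] vsum_comm[OF AB] by (simp only:)
  qed
  then show "subspace_sum B A = B" using vsum_comm[OF AB] by (simp only:)
qed

section \<open>Lowering the rank of chosen planes\<close>

text \<open>For empty \<open>S\<close> this is the uniform rank function
  \<open>min (subspace_dim A) 2\<close>.\<close>

definition lowered_rank :: "'a vec set set \<Rightarrow> 'a vec set \<Rightarrow> nat" where
  "lowered_rank S A = (if subspace_dim A \<le> 1 then subspace_dim A else if A \<in> S then 1 else 2)"

text \<open>Monotonicity holds because a member of \<open>S\<close> properly contains only subspaces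
  of dimension at most one. Submodularity is trivial for nested pairs; otherwise the sum has rank at
  most two, and the intersection is small enough to compensate.\<close>

lemma q_matroid_lowered_rank:
  assumes dim2: "\<And>W. W \<in> S \<Longrightarrow> subspace_dim W = 2"
    and disj: "\<And>W W'. W \<in> S \<Longrightarrow> W' \<in> S \<Longrightarrow> W \<noteq> W' \<Longrightarrow> W \<inter> W' = {0\<^sub>v n}"
  shows "q_matroid (lowered_rank S)"
  unfolding q_matroid_def
proof (intro conjI ballI impI)
  fix A assume A: "A \<in> subspaces"
  show "lowered_rank S A \<le> subspace_dim A" by (simp add: lowered_rank_def)
  fix B assume B: "B \<in> subspaces"
  show "lowered_rank S A \<le> lowered_rank S B" if "A \<subseteq> B"
  proof (cases "A = B")
    case False
    then have "subspace_dim A < subspace_dim B" using that A B by (intro subspace_dim_strict_mono) auto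
    then show ?thesis using dim2[of B] by (auto simp: lowered_rank_def)
  qed simp
  show "lowered_rank S (A \<inter> B) + lowered_rank S (subspace_sum A B) \<le> lowered_rank S A + lowered_rank S B"
  proof -
    consider "A \<subseteq> B" | "B \<subseteq> A" | "A \<inter> B \<subset> A" "A \<inter> B \<subset> B" by blast
    then show ?thesis
    proof cases
      case 1
      then have "A \<inter> B = A" by blast
      then show ?thesis unfolding subspace_sum_absorb(1)[OF A B 1] by simp
    next
      case 2
      then have "A \<inter> B = B" by blast
      then show ?thesis unfolding subspace_sum_absorb(2)[OF B A 2] by simp
    next
      case 3
      note AB = Int_in_subspaces[OF A B]
      have lt: "subspace_dim (A \<inter> B) < subspace_dim A" "subspace_dim (A \<inter> B) < subspace_dim B"
        using subspace_dim_strict_mono[OF AB A 3(1)] subspace_dim_strict_mono[OF AB B 3(2)] by simp_all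
      have zero: "subspace_dim (A \<inter> B) = 0" if "A \<in> S" "B \<in> S"
      proof -
        have "A \<noteq> B" using 3 by blast
        then show ?thesis using disj[OF that] subspace_dim_zero by simp
      qed
      have "lowered_rank S (subspace_sum A B) \<le> 2" by (simp add: lowered_rank_def)
      \<comment> \<open>If both \<open>A\<close> and \<open>B\<close> are in \<open>S\<close>, their
        intersection is zero and this reads \<open>0 + 2 \<le> 1 + 1\<close>. In the other cases the
        strict drop in dimension from both to the intersection suffices.\<close>
      moreover have "lowered_rank S (A \<inter> B) + 2 \<le> lowered_rank S A + lowered_rank S B"
        using lt zero dim2[of A] dim2[of B] unfolding lowered_rank_def
        by (cases "A \<in> S"; cases "B \<in> S"; simp)
      ultimately show ?thesis by linarith
    qed
  qed
qed

lemma restrict_q_matroid: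
  assumes "q_matroid \<rho>"
  shows "restrict \<rho> subspaces \<in> q_matroids"
  using assms Int_in_subspaces subspace_sum_in_subspaces
  unfolding q_matroids_def q_matroid_def by simp

section \<open>A large family of planes with pairwise trivial intersection\<close>

text \<open>Combines the first \<open>n\<close> terms of \<open>x\<close> with those of its shift by
  one. The shift links neighbouring coordinates, so that a recurrence controls the intersection of
  two planes.\<close>

definition plane_vec :: "(nat \<Rightarrow> 'a) \<Rightarrow> 'a \<Rightarrow> 'a \<Rightarrow> 'a vec" where
  "plane_vec x a b = vec n (\<lambda>i. a * x i + b * x (Suc i))"

definition plane :: "(nat \<Rightarrow> 'a) \<Rightarrow> 'a vec set" where
  "plane x = {plane_vec x a b | a b. True}"

text \<open>
  The fixed entries put the identity matrix into the first two coordinates of the generators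
  \<open>(x\<^sub>i)\<close> and \<open>(x\<^sub>i\<^sub>+\<^sub>1)\<close> of \<^term>\<open>plane x\<close>.
\<close>

definition seqs :: "(nat \<Rightarrow> 'a) set" where
  "seqs = {x. x 0 = 1 \<and> x 1 = 0 \<and> x 2 = 1 \<and> (\<forall>i\<ge>n. x i = 0)}"

context
  assumes n3: "3 \<le> n"
begin

text \<open>Coordinates 0 and 1 of a vector are its coefficients whatever the sequence, so vectors
  of two different planes can be compared.\<close>

lemma plane_vec_inject:
  assumes "x \<in> seqs" "y \<in> seqs" "plane_vec x a b = plane_vec y c d"
  shows "a = c" "b = d"
proof -
  have "a * x i + b * x (Suc i) = c * y i + d * y (Suc i)" if "i < n" for i
    using arg_cong[OF assms(3), of "\<lambda>v. vec_index v i"] that by (simp add: plane_vec_def)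
  from this[of 0] this[of 1] show "a = c" "b = d"
    using assms(1,2) n3 by (simp_all add: seqs_def numeral_2_eq_2)
qed

lemma plane_in_subspaces: "plane x \<in> subspaces"
proof -
  have "0\<^sub>v n = plane_vec x 0 0" by (auto simp: plane_vec_def)
  moreover have "plane_vec x a b + plane_vec x c d = plane_vec x (a + c) (b + d)" for a b c d
    by (auto simp: plane_vec_def algebra_simps)
  moreover have "e \<cdot>\<^sub>v plane_vec x a b = plane_vec x (e * a) (e * b)" for a b e
    by (auto simp: plane_vec_def algebra_simps)
  moreover have "plane_vec x a b \<in> carrier_vec n" for a b by (simp add: plane_vec_def)
  ultimately show ?thesis unfolding subspace_iff plane_def by auto blast+
qed

lemma subspace_dim_plane:
  assumes x: "x \<in> seqs"
  shows "subspace_dim (plane x) = 2"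
proof -
  have "inj (\<lambda>(a, b). plane_vec x a b)" using plane_vec_inject[OF x x] by (auto simp: inj_def)
  moreover have "plane x = range (\<lambda>(a, b). plane_vec x a b)" by (auto simp: plane_def)
  ultimately have "card (plane x) = CARD('a \<times> 'a)" by (simp only: card_image)
  also have "\<dots> = CARD('a) ^ 2" by (simp add: power2_eq_square)
  finally show ?thesis using card_subspace[OF plane_in_subspaces] card_field_gt_1
    by (simp add: power_inject_exp)
qed

text \<open>A common vector has the same coefficients in both planes, so the difference
  \<open>z\<close> of the sequences satisfies \<open>a * z i + b * z (Suc i) = 0\<close> for
  \<open>i < n\<close>. The last nonzero term of \<open>z\<close> gives \<open>a = 0\<close>, and
  the position before it gives \<open>b = 0\<close>.\<close>

lemma plane_Int:
  assumes x: "x \<in> seqs" and y: "y \<in> seqs" and ne: "x \<noteq> y"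
  shows "plane x \<inter> plane y = {0\<^sub>v n}"
proof
  have "0\<^sub>v n \<in> plane x \<inter> plane y" using plane_in_subspaces subspace_iff by blast
  then show "{0\<^sub>v n} \<subseteq> plane x \<inter> plane y" by blast
  show "plane x \<inter> plane y \<subseteq> {0\<^sub>v n}"
  proof
    fix v assume "v \<in> plane x \<inter> plane y"
    then have "v \<in> plane x" "v \<in> plane y" by simp_all
    from this(1) obtain a b where va: "v = plane_vec x a b" unfolding plane_def by blast
    from \<open>v \<in> plane y\<close> obtain c d where vc: "v = plane_vec y c d" unfolding plane_def by blast
    have eq: "plane_vec x a b = plane_vec y c d" by (rule trans[OF va[symmetric] vc])
    have cd: "c = a" "d = b" using plane_vec_inject[OF x y eq] by simp_all
    define z where "z i = x i - y i" for i
    have z: "a * z i + b * z (Suc i) = 0" if "i < n" for i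
      using arg_cong[OF eq, of "\<lambda>v. vec_index v i"] that
      by (simp add: plane_vec_def cd z_def algebra_simps)
    have z_n: "z i = 0" if "n \<le> i" for i using that x y by (simp add: z_def seqs_def)
    obtain i0 where "z i0 \<noteq> 0" using ne by (auto simp: z_def fun_eq_iff)
    define i where "i = (GREATEST i. z i \<noteq> 0)"
    have bound: "\<And>j. z j \<noteq> 0 \<Longrightarrow> j \<le> n" using z_n by (meson nat_le_linear)
    have zi: "z i \<noteq> 0" unfolding i_def by (rule GreatestI_nat[where P = "\<lambda>i. z i \<noteq> 0", OF \<open>z i0 \<noteq> 0\<close> bound])
    have "z (Suc i) = 0"
    proof (rule ccontr)
      assume "z (Suc i) \<noteq> 0"
      then have "Suc i \<le> i" unfolding i_def by (rule Greatest_le_nat[where P = "\<lambda>i. z i \<noteq> 0", OF _ bound])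
      then show False by simp
    qed
    moreover have "i < n" using zi z_n by (meson not_le)
    ultimately have "a = 0" using z[of i] zi by simp
    \<comment> \<open>Both sequences start with 1, so there is a position before
      \<open>i\<close>.\<close>
    have "i \<noteq> 0" using zi x y by (cases i) (auto simp: z_def seqs_def)
    then obtain j where j: "i = Suc j" by (cases i) auto
    then have "b = 0" using z[of j] \<open>i < n\<close> zi \<open>a = 0\<close> by simp
    then show "v \<in> {0\<^sub>v n}" using va \<open>a = 0\<close> by (auto simp: plane_vec_def)
  qed
qed

lemma inj_on_plane: "inj_on plane seqs"
proof (rule inj_onI)
  fix x y assume xy: "x \<in> seqs" "y \<in> seqs" "plane x = plane y"
  show "x = y"
  proof (rule ccontr)
    assume "x \<noteq> y"
    then have "plane x = {0\<^sub>v n}" using plane_Int[OF xy(1,2)] xy(3) by simp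
    then show False using subspace_dim_plane[OF xy(1)] subspace_dim_zero by simp
  qed
qed

text \<open>The entries at positions 3 to \<open>n - 1\<close> are free and all others are
  prescribed.\<close>

lemma card_seqs: "finite seqs" "CARD('a) ^ (n - 3) \<le> card seqs"
proof -
  define f where "f y i = (if i = 0 \<or> i = 2 then 1 else if i \<in> {3..<n} then y i else 0)"
    for y :: "nat \<Rightarrow> 'a" and i
  have inj: "inj_on f ({3..<n} \<rightarrow>\<^sub>E UNIV)"
  proof (rule inj_onI)
    fix y y' assume y: "y \<in> {3..<n} \<rightarrow>\<^sub>E UNIV" "y' \<in> {3..<n} \<rightarrow>\<^sub>E UNIV" and eq: "f y = f y'"
    have "y i = y' i" if "i \<in> {3..<n}" for i
      using fun_cong[OF eq, of i] that by (simp add: f_def)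
    then show "y = y'" by (rule PiE_ext[OF y])
  qed
  have img: "f ` ({3..<n} \<rightarrow>\<^sub>E UNIV) = seqs"
  proof
    show "f ` ({3..<n} \<rightarrow>\<^sub>E UNIV) \<subseteq> seqs" using n3 by (auto simp: f_def seqs_def)
    show "seqs \<subseteq> f ` ({3..<n} \<rightarrow>\<^sub>E UNIV)"
    proof
      fix x assume x: "x \<in> seqs"
      have "x i = f (restrict x {3..<n}) i" for i
      proof -
        consider "i = 0" | "i = 1" | "i = 2" | "i \<in> {3..<n}" | "n \<le> i" by force
        then show ?thesis using x n3 by cases (auto simp: f_def seqs_def)
      qed
      then have "x = f (restrict x {3..<n})" by (rule ext)
      then show "x \<in> f ` ({3..<n} \<rightarrow>\<^sub>E UNIV)" by (rule image_eqI[where x = "restrict x {3..<n}"]) simp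
    qed
  qed
  have "finite ({3..<n} \<rightarrow>\<^sub>E (UNIV :: 'a set))" by (intro finite_PiE) simp_all
  then show "finite seqs" unfolding img[symmetric] by (rule finite_imageI)
  show "CARD('a) ^ (n - 3) \<le> card seqs"
    unfolding img[symmetric] card_image[OF inj] by (simp add: card_PiE)
qed

text \<open>Each set \<open>T\<close> of sequences yields a \<open>q\<close>-matroid whose value at
  \<open>plane x\<close> reveals whether \<open>x\<close> belongs to \<open>T\<close>, so different
  sets yield different functions.\<close>

lemma card_q_matroids_ge: "2 ^ CARD('a) ^ (n - 3) \<le> card q_matroids"
proof -
  define f where "f T = restrict (lowered_rank (plane ` T)) subspaces" for T
  have mem: "f T \<in> q_matroids" if "T \<subseteq> seqs" for T
    unfolding f_def
  proof (intro restrict_q_matroid q_matroid_lowered_rank)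
    fix W assume "W \<in> plane ` T"
    then obtain x where x: "x \<in> T" "W = plane x" by blast
    then have "x \<in> seqs" using that by blast
    then show "subspace_dim W = 2" unfolding x(2) by (rule subspace_dim_plane)
    fix W' assume "W' \<in> plane ` T" and ne: "W \<noteq> W'"
    then obtain y where y: "y \<in> T" "W' = plane y" by blast
    then have "y \<in> seqs" using that by blast
    moreover have "x \<noteq> y" using ne x(2) y(2) by blast
    ultimately show "W \<inter> W' = {0\<^sub>v n}"
      unfolding x(2) y(2) using \<open>x \<in> seqs\<close> by (intro plane_Int)
  qed
  have val: "f T (plane x) = (if x \<in> T then 1 else 2)" if "T \<subseteq> seqs" "x \<in> seqs" for T x
    using subspace_dim_plane[OF that(2)] plane_in_subspaces[of x]
      inj_on_image_mem_iff[OF inj_on_plane that(2,1)]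
    by (simp add: f_def lowered_rank_def)
  have inj: "inj_on f (Pow seqs)"
  proof (rule inj_onI)
    fix T T' assume T: "T \<in> Pow seqs" "T' \<in> Pow seqs" and eq: "f T = f T'"
    have "x \<in> T \<longleftrightarrow> x \<in> T'" if x: "x \<in> seqs" for x
    proof -
      have "T \<subseteq> seqs" "T' \<subseteq> seqs" using T by simp_all
      note vals = val[OF this(1) x] val[OF this(2) x]
      from fun_cong[OF eq, of "plane x"] show ?thesis unfolding vals by (simp split: if_splits)
    qed
    then show "T = T'" using T by blast
  qed
  have "2 ^ CARD('a) ^ (n - 3) \<le> (2::nat) ^ card seqs" using card_seqs(2) by (rule power_increasing) simp
  also have "\<dots> = card (Pow seqs)" using card_seqs(1) by (simp add: card_Pow)
  also have "\<dots> \<le> card q_matroids"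
  proof (rule card_inj_on_le[OF inj])
    show "f ` Pow seqs \<subseteq> q_matroids" using mem by blast
  qed (rule finite_q_matroids)
  finally show ?thesis .
qed

end

end

lemma num_q_matroids_ge:
  assumes "3 \<le> n"
  shows "2 ^ CARD('a) ^ (n - 3) \<le> num_q_matroids TYPE('a::{finite,field}) n"
proof -
  interpret finite_vec_space "TYPE('a)" n .
  show ?thesis using card_q_matroids_ge[OF assms] by (simp add: num_q_matroids_def)
qed


section \<open>The limit\<close>

text \<open>Both counts are compared with powers of two: bounding \<open>n\<close> by
  \<open>2 ^ n\<close> and \<open>?q\<close> by \<open>2 ^ ?q\<close> leaves an exponent polynomial
  in \<open>n\<close> above, while \<open>2 \<le> ?q\<close> gives \<open>2 ^ 2 ^ (n - 3)\<close>
  below.\<close>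

lemma num_representable_ratio_le:
  assumes "3 \<le> n"
  shows "real (num_representable TYPE('a::{finite,field}) n) / real (num_q_matroids TYPE('a) n)
    \<le> 2 powr (real n + (real n + real CARD('a) * real n ^ 2 + 1) * real n ^ 2 - 2 powr (real n - 3))"
proof -
  let ?q = "CARD('a)"
  have q2: "2 \<le> ?q"
  proof -
    have "card {0, 1 :: 'a} \<le> ?q" by (intro card_mono) auto
    then show ?thesis by simp
  qed
  have n1: "n + 1 \<le> 2 ^ n" using less_exp[of n] by (simp only: Suc_eq_plus1[symmetric] Suc_le_eq)
  \<comment> \<open>The final 1 in the exponent is a factor two that absorbs the added one.\<close>
  have "n * ?q ^ (n * n) + 1 \<le> 2 ^ (n + ?q * n ^ 2 + 1)"
  proof -
    have "?q ^ (n * n) \<le> (2 ^ ?q) ^ (n * n)" by (intro power_mono less_imp_le[OF less_exp]) simp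
    also have "\<dots> = 2 ^ (?q * n ^ 2)" by (simp add: power_mult power2_eq_square)
    finally have "n * ?q ^ (n * n) \<le> 2 ^ n * 2 ^ (?q * n ^ 2)"
      by (intro mult_mono less_imp_le[OF less_exp]) simp_all
    moreover have "1 \<le> (2::nat) ^ n * 2 ^ (?q * n ^ 2)" by simp
    ultimately show ?thesis unfolding power_add power_one_right by linarith
  qed
  then have "(n * ?q ^ (n * n) + 1) ^ (n * n) \<le> (2 ^ (n + ?q * n ^ 2 + 1)) ^ (n * n)"
    by (intro power_mono) simp_all
  also have "\<dots> = 2 ^ ((n + ?q * n ^ 2 + 1) * n ^ 2)"
    unfolding power_mult power2_eq_square[of n] by (simp only: power_mult[symmetric])
  finally have "(n + 1) * (n * ?q ^ (n * n) + 1) ^ (n * n) \<le> 2 ^ n * 2 ^ ((n + ?q * n ^ 2 + 1) * n ^ 2)"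
    using n1 by (intro mult_mono) simp_all
  then have "num_representable TYPE('a) n \<le> 2 ^ (n + (n + ?q * n ^ 2 + 1) * n ^ 2)"
    using num_representable_le[of n, where ?'a = 'a] unfolding power_add[of 2 n] by (rule order_trans[rotated])
  then have R: "real (num_representable TYPE('a) n) \<le> 2 powr (real (n + (n + ?q * n ^ 2 + 1) * n ^ 2))"
    unfolding powr_realpow[OF zero_less_numeral] by (metis of_nat_le_iff of_nat_numeral of_nat_power)
  have "2 ^ 2 ^ (n - 3) \<le> (2::nat) ^ ?q ^ (n - 3)" using q2 by (intro power_increasing power_mono) simp_all
  also note num_q_matroids_ge[OF assms]
  finally have "(2::real) ^ 2 ^ (n - 3) \<le> real (num_q_matroids TYPE('a) n)"
    by (metis of_nat_le_iff of_nat_numeral of_nat_power)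
  moreover have "2 powr (2 powr (real n - 3)) = (2::real) ^ 2 ^ (n - 3)"
  proof -
    \<comment> \<open>Truncated subtraction agrees with real subtraction here because
      \<open>3 \<le> n\<close>.\<close>
    have "2 powr (real n - 3) = 2 powr real (n - 3)" using assms by (simp add: of_nat_diff)
    also have "\<dots> = real (2 ^ (n - 3))" by (simp add: powr_realpow)
    finally show ?thesis by (simp only: powr_realpow[OF zero_less_numeral])
  qed
  ultimately have N: "2 powr (2 powr (real n - 3)) \<le> real (num_q_matroids TYPE('a) n)" by (simp only:)
  have "real (num_representable TYPE('a) n) / real (num_q_matroids TYPE('a) n)
    \<le> 2 powr (real (n + (n + ?q * n ^ 2 + 1) * n ^ 2)) / 2 powr (2 powr (real n - 3))"
    using R N by (intro frac_le) simp_all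
  then show ?thesis unfolding powr_diff by (simp only: of_nat_add of_nat_mult of_nat_power of_nat_1)
qed

theorem theorem1p2:
  shows "(\<lambda>n. real (num_representable TYPE('a::{finite,field}) n) /
              real (num_q_matroids TYPE('a) n)) \<longlonglongrightarrow> 0"
proof (rule tendsto_sandwich[OF _ _ tendsto_const])
  define q where "q = real CARD('a)"
  have "q > 0" by (simp add: q_def)
  \<comment> \<open>The exponent is a polynomial in \<open>n\<close> minus an exponential, so it
    tends to minus infinity for any fixed positive \<open>q\<close>.\<close>
  then show "(\<lambda>n. 2 powr (real n + (real n + q * real n ^ 2 + 1) * real n ^ 2 - 2 powr (real n - 3))) \<longlonglongrightarrow> 0"
    by real_asymp
  show "\<forall>\<^sub>F n in sequentially. real (num_representable TYPE('a) n) / real (num_q_matroids TYPE('a) n)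
    \<le> 2 powr (real n + (real n + q * real n ^ 2 + 1) * real n ^ 2 - 2 powr (real n - 3))"
    using eventually_ge_at_top[of 3] unfolding q_def
    by (rule eventually_mono) (rule num_representable_ratio_le)
qed simp

end
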